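(* Let $\mathcal{D}$ be a distribution on $\mathbb{R}^d$, $f$ a linear threshold function on $\mathbb{R}^d$, $q\ge2$, $1\le k\le q-1$, and let $\mathcal{M}$ be a collection of $m$ bags sampled i.i.d. from $\mathrm{Ex}(f,\mathcal{D},q,k)$. There is an absolute constant $C_0\le1000$ such that for any $\delta,\varepsilon>0$, if $m\ge C_0d(\log q+\log(1/\delta))/\varepsilon^2$, then with probability at least $1-\delta$ over $\mathcal{M}$, every linear threshold function $h$ on $\mathbb{R}^d$ satisfies $\mathrm{BagErr}_{\mathrm{oracle}}(h,f,\mathcal{D},q,k)\le\mathrm{BagErr}_{\mathrm{sample}}(h,\mathcal{M})+\varepsilon$.
   Context: A linear threshold function is $\mathbf{x}\mapsto\mathrm{pos}(\mathbf{r}^{\mathsf T}\mathbf{x}+c)$, $\mathrm{pos}(a)=1$ if $a>0$ else $0$. The bag oracle $\mathrm{Ex}(f,\mathcal{D},q,k)$ returns a bag of $q$ independent points, $k$ drawn from $\mathcal{D}$ conditioned on $f=1$ and $q-k$ from $\mathcal{D}$ conditioned on $f=0$. $\mathrm{BagErr}_{\mathrm{oracle}}(h,f,\mathcal{D},q,k):=\Pr_{B\sim\mathrm{Ex}(f,\mathcal{D},q,k)}[\mathrm{Avg}\{h(\mathbf{x}):\mathbf{x}\in B\}\neq k/q]$ and $\mathrm{BagErr}_{\mathrm{sample}}(h,\mathcal{M}):=|\{B\in\mathcal{M}:\mathrm{Avg}\{h(\mathbf{x}):\mathbf{x}\in B\}\neq k/q\}|/m$. *)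

theory Defs
  imports "HOL-Probability.Probability"
begin

text \<open>Points of R^d are represented as functions nat => real (coordinates i < d),
  living in the product space PiM {..<d} (\<lambda>_. borel).\<close>

definition ltf :: "nat \<Rightarrow> (nat \<Rightarrow> real) \<Rightarrow> real \<Rightarrow> (nat \<Rightarrow> real) \<Rightarrow> real" where
  "ltf d r c x = (if (\<Sum>i<d. r i * x i) + c > 0 then 1 else 0)"

definition is_ltf :: "nat \<Rightarrow> ((nat \<Rightarrow> real) \<Rightarrow> real) \<Rightarrow> bool" where
  "is_ltf d h \<longleftrightarrow> (\<exists>r c. h = ltf d r c)"

definition bag_oracle :: "(nat \<Rightarrow> real) measure \<Rightarrow> ((nat \<Rightarrow> real) \<Rightarrow> real) \<Rightarrow> nat \<Rightarrow> nat
    \<Rightarrow> (nat \<Rightarrow> (nat \<Rightarrow> real)) measure" where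
  "bag_oracle D f q k = PiM {..<q} (\<lambda>i. if i < k
       then uniform_measure D {x \<in> space D. f x = 1}
       else uniform_measure D {x \<in> space D. f x = 0})"

definition bag_avg :: "((nat \<Rightarrow> real) \<Rightarrow> real) \<Rightarrow> nat \<Rightarrow> (nat \<Rightarrow> (nat \<Rightarrow> real)) \<Rightarrow> real" where
  "bag_avg h q B = (\<Sum>i<q. h (B i)) / real q"

definition bag_err_oracle :: "((nat \<Rightarrow> real) \<Rightarrow> real) \<Rightarrow> ((nat \<Rightarrow> real) \<Rightarrow> real)
    \<Rightarrow> (nat \<Rightarrow> real) measure \<Rightarrow> nat \<Rightarrow> nat \<Rightarrow> real" where
  "bag_err_oracle h f D q k =
     measure (bag_oracle D f q k)
       {B \<in> space (bag_oracle D f q k). bag_avg h q B \<noteq> real k / real q}"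

definition bag_err_sample :: "((nat \<Rightarrow> real) \<Rightarrow> real) \<Rightarrow> nat \<Rightarrow> nat \<Rightarrow> nat
    \<Rightarrow> (nat \<Rightarrow> nat \<Rightarrow> (nat \<Rightarrow> real)) \<Rightarrow> real" where
  "bag_err_sample h q k m M =
     real (card {j \<in> {..<m}. bag_avg h q (M j) \<noteq> real k / real q}) / real m"

definition bag_sample_space :: "(nat \<Rightarrow> real) measure \<Rightarrow> ((nat \<Rightarrow> real) \<Rightarrow> real) \<Rightarrow> nat \<Rightarrow> nat
    \<Rightarrow> nat \<Rightarrow> (nat \<Rightarrow> nat \<Rightarrow> (nat \<Rightarrow> real)) measure" where
  "bag_sample_space D f q k m = PiM {..<m} (\<lambda>_. bag_oracle D f q k)"

end

theory Submission
  imports Defs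
begin

text \<open>The constant is \<open>C0 = 1000\<close>. Since no factor \<open>log (1 / \<epsilon>)\<close> is available in the sample size, a
  union bound over all traces of halfspaces on the sample is too weak, and the proof is a chaining
  argument. After symmetrization with a ghost sample and random swaps it remains to bound a Rademacher
  process indexed by the traces on the \<open>2m\<close> bags. Halfspaces shatter at most \<open>d + 1\<close> points, so by the
  Sauer--Shelah lemma there are at most \<open>x\<^sup>-\<^sup>D exp (x n)\<close> traces on \<open>n\<close> points, where \<open>D = d + 1\<close> and
  \<open>0 < x \<le> 1\<close> is free. An \<open>\<eta>\<close>-separated set of \<open>N\<close> traces on bags is already separated by some
  \<open>2 ln N / \<eta>\<close> bags, whence \<open>ln N \<le> 3/2 D ln (8 q / \<eta>)\<close>. Chaining through nets of radius
  \<open>16\<^sup>-\<^sup>j\<close> with deviations proportional to \<open>2\<^sup>-\<^sup>j\<close> then gives failure probabilities summing to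
  \<open>\<delta>\<close>. Measurability is never an issue: halfspaces are pointwise limits of rational ones, so
  finite families suffice.\<close>

section \<open>Traces of halfspaces\<close>

definition shatters :: "'a set set \<Rightarrow> 'a set \<Rightarrow> bool" where
  "shatters F Y \<longleftrightarrow> (\<forall>Z\<subseteq>Y. \<exists>A\<in>F. A \<inter> Y = Z)"

lemma shatters_mono: "shatters F Y \<Longrightarrow> F \<subseteq> G \<Longrightarrow> shatters G Y"
  unfolding shatters_def by blast

text \<open>Pajor's form of the Sauer--Shelah lemma.\<close>

lemma card_le_card_shattered:
  assumes "finite X" "F \<subseteq> Pow X"
  shows "card F \<le> card {Y. Y \<subseteq> X \<and> shatters F Y}"
  using assms
proof (induction X arbitrary: F rule: finite_induct)
  case empty
  then have "F = {} \<or> F = {{}}" by auto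
  moreover have "{Y::'a set. Y \<subseteq> {} \<and> shatters {{}} Y} = {{}}"
    by (auto simp: shatters_def)
  ultimately show ?case by (elim disjE) simp_all
next
  case (insert x X)
  define F0 where "F0 = {A\<in>F. x \<notin> A}"
  define F1 where "F1 = (\<lambda>A. A - {x}) ` {A\<in>F. x \<in> A}"
  define S0 where "S0 = {Y. Y \<subseteq> X \<and> shatters F0 Y}"
  define S1 where "S1 = {Y. Y \<subseteq> X \<and> shatters F1 Y}"
  have finF: "finite F"
    using insert.prems insert.hyps by (meson finite.insertI finite_Pow_iff finite_subset)
  have fin: "finite S0" "finite S1"
    using insert.hyps unfolding S0_def S1_def by auto
  have sub: "F0 \<subseteq> Pow X" "F1 \<subseteq> Pow X"
    using insert.prems unfolding F0_def F1_def by auto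
  have "card F = card F0 + card {A\<in>F. x \<in> A}"
  proof -
    have "F = F0 \<union> {A\<in>F. x \<in> A}" "F0 \<inter> {A\<in>F. x \<in> A} = {}"
      unfolding F0_def by auto
    then show ?thesis
      using finF card_Un_disjoint[of F0 "{A\<in>F. x \<in> A}"] by (simp add: F0_def)
  qed
  also have "card {A\<in>F. x \<in> A} = card F1"
    unfolding F1_def by (rule card_image [symmetric]) (auto simp: inj_on_def)
  finally have "card F \<le> card S0 + card S1"
    using insert.IH[OF sub(1)] insert.IH[OF sub(2)] unfolding S0_def S1_def by linarith
  \<comment> \<open>A set \<open>Y\<close> lying in both \<open>S0\<close> and \<open>S1\<close> is
    counted twice, and rightly so: \<open>Y\<close> and \<open>insert x Y\<close> are then both
    shattered by \<open>F\<close>, since \<open>x\<close> can be included or left out at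
    will.\<close>
  also have "\<dots> = card (S0 \<union> S1) + card (S0 \<inter> S1)"
    using fin by (rule card_Un_Int)
  also have "card (S0 \<inter> S1) = card (insert x ` (S0 \<inter> S1))"
  proof (rule card_image [symmetric], rule inj_onI)
    fix Y Z assume "Y \<in> S0 \<inter> S1" "Z \<in> S0 \<inter> S1" "insert x Y = insert x Z"
    moreover from this insert.hyps have "x \<notin> Y" "x \<notin> Z" unfolding S0_def by auto
    ultimately show "Y = Z" by (simp add: insert_ident)
  qed
  also have "card (S0 \<union> S1) + \<dots> = card (S0 \<union> S1 \<union> insert x ` (S0 \<inter> S1))"
    by (rule card_Un_disjoint [symmetric])
      (use insert.hyps fin in \<open>auto simp: S0_def S1_def\<close>)
  also have "\<dots> \<le> card {Y. Y \<subseteq> insert x X \<and> shatters F Y}"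
  proof (rule card_mono)
    show "finite {Y. Y \<subseteq> insert x X \<and> shatters F Y}"
      using insert.hyps by auto
    have 1: "shatters F Y" if "Y \<subseteq> X" "shatters F1 Y" for Y
      unfolding shatters_def
    proof safe
      fix Z assume "Z \<subseteq> Y"
      with that obtain A where "A \<in> F" "x \<in> A" "(A - {x}) \<inter> Y = Z"
        unfolding shatters_def F1_def by (auto dest!: spec[of _ Z])
      with that insert.hyps show "\<exists>A\<in>F. A \<inter> Y = Z" by blast
    qed
    have 2: "shatters F (insert x Y)" if "Y \<subseteq> X" "shatters F0 Y" "shatters F1 Y" for Y
      unfolding shatters_def
    proof safe
      fix Z assume Z: "Z \<subseteq> insert x Y"
      show "\<exists>A\<in>F. A \<inter> insert x Y = Z"
      proof (cases "x \<in> Z")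
        case True
        have "Z - {x} \<subseteq> Y" using Z by auto
        with that obtain A where A: "A \<in> F" "x \<in> A" "(A - {x}) \<inter> Y = Z - {x}"
          unfolding shatters_def F1_def by (auto dest!: spec[of _ "Z - {x}"])
        have "A \<inter> insert x Y = Z" using A True Z insert.hyps that(1) by blast
        with A show ?thesis by blast
      next
        case False
        then have "Z \<subseteq> Y" using Z by auto
        with that obtain A where A: "A \<in> F" "x \<notin> A" "A \<inter> Y = Z"
          unfolding shatters_def F0_def by blast
        have "A \<inter> insert x Y = Z" using A by auto
        with A show ?thesis by blast
      qed
    qed
    show "S0 \<union> S1 \<union> insert x ` (S0 \<inter> S1) \<subseteq> {Y. Y \<subseteq> insert x X \<and> shatters F Y}"
      using 1 2 unfolding S0_def S1_def
      by (auto intro: shatters_mono[where F = F0] simp: F0_def)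
  qed
  finally show ?case .
qed

text \<open>Since \<open>x \<le> 1\<close>, the weight \<open>x ^ D\<close> is at most
  \<open>x ^ i\<close> for \<open>i \<le> D\<close>, so the weighted sum is dominated by the full
  expansion of \<open>(1 + x) ^ n\<close>. Leaving \<open>x\<close> free, instead of taking
  \<open>x = D / n\<close>, lets the packing bound balance the two factors.\<close>

lemma sum_choose_le_exp:
  fixes x :: real
  assumes "0 < x" "x \<le> 1"
  shows "(\<Sum>i\<le>D. real (n choose i)) \<le> (1 / x) ^ D * exp (x * n)"
proof -
  have "(\<Sum>i\<le>D. real (n choose i)) * x ^ D \<le> (\<Sum>i\<le>D. real (n choose i) * x ^ i)"
    unfolding sum_distrib_right
    by (intro sum_mono mult_left_mono power_decreasing) (use assms in auto)
  also have "\<dots> \<le> (\<Sum>i\<le>D + n. real (n choose i) * x ^ i)"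
    by (rule sum_mono2) (use assms in auto)
  also have "\<dots> = (\<Sum>i\<le>n. real (n choose i) * x ^ i)"
    by (rule sum.mono_neutral_right) auto
  also have "\<dots> = (x + 1) ^ n"
    by (subst binomial_ring) simp
  also have "\<dots> \<le> exp x ^ n"
    by (rule power_mono) (use assms exp_ge_add_one_self[of x] in \<open>auto simp: add.commute\<close>)
  finally show ?thesis
    using assms by (simp add: field_simps exp_of_nat2_mult)
qed

lemma card_le_of_no_large_shattered:
  fixes x :: real
  assumes "finite X" "F \<subseteq> Pow X" "\<And>Y. Y \<subseteq> X \<Longrightarrow> shatters F Y \<Longrightarrow> card Y \<le> D"
    and "0 < x" "x \<le> 1"
  shows "real (card F) \<le> (1 / x) ^ D * exp (x * card X)"
proof -
  have "card F \<le> card {Y. Y \<subseteq> X \<and> shatters F Y}"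
    using assms by (intro card_le_card_shattered) auto
  also have "\<dots> \<le> card (\<Union>i\<le>D. {Y. Y \<subseteq> X \<and> card Y = i})"
    using assms by (intro card_mono) auto
  also have "\<dots> \<le> (\<Sum>i\<le>D. card {Y. Y \<subseteq> X \<and> card Y = i})"
    by (rule card_UN_le) auto
  also have "\<dots> = (\<Sum>i\<le>D. card X choose i)"
    using n_subsets[OF assms(1)] by simp
  finally have "real (card F) \<le> (\<Sum>i\<le>D. real (card X choose i))"
    by (metis of_nat_le_iff of_nat_sum)
  also have "\<dots> \<le> (1 / x) ^ D * exp (x * card X)"
    using assms by (intro sum_choose_le_exp)
  finally show ?thesis .
qed

section \<open>Linear dependence and the shattering bound for halfspaces\<close>

text \<open>Gaussian elimination, by induction on the number of equations: an unknown
  \<open>p\<close> that occurs in the last equation is eliminated from the others; if there is none,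
  that equation holds trivially.\<close>

lemma homogeneous_system_nontrivial_solution:
  fixes a :: "nat \<Rightarrow> 's \<Rightarrow> real"
  assumes "finite S" "n < card S"
  shows "\<exists>l. (\<exists>s\<in>S. l s \<noteq> 0) \<and> (\<forall>i<n. (\<Sum>s\<in>S. l s * a i s) = 0)"
  using assms
proof (induction n arbitrary: S a)
  case 0
  then have "S \<noteq> {}" by auto
  then show ?case by (auto intro!: exI[of _ "\<lambda>_. 1"])
next
  case (Suc n)
  show ?case
  proof (cases "\<exists>p\<in>S. a n p \<noteq> 0")
    case False
    have "n < card S" using Suc.prems by simp
    from Suc.IH[OF Suc.prems(1) this] obtain l where
      "\<exists>s\<in>S. l s \<noteq> 0" "\<forall>i<n. (\<Sum>s\<in>S. l s * a i s) = 0" by blast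
    then show ?thesis
      using False by (intro exI[of _ l]) (auto simp: less_Suc_eq)
  next
    case True
    then obtain p where p: "p \<in> S" "a n p \<noteq> 0" by blast
    define b where "b i s = a i s - a i p * a n s / a n p" for i s
    have "n < card (S - {p})" "finite (S - {p})"
      using Suc.prems p by auto
    from Suc.IH[OF this(2,1), of b] obtain l where
      l: "\<exists>s\<in>S - {p}. l s \<noteq> 0" "\<forall>i<n. (\<Sum>s\<in>S - {p}. l s * b i s) = 0" by blast
    define t where "t = - (\<Sum>s\<in>S - {p}. l s * a n s) / a n p"
    define l' where "l' = l(p := t)"
    have split: "(\<Sum>s\<in>S. l' s * a i s) = t * a i p + (\<Sum>s\<in>S - {p}. l s * a i s)" for i
      using Suc.prems p
      by (subst sum.remove[of S p]) (auto simp: l'_def intro!: sum.cong)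
    have "(\<Sum>s\<in>S. l' s * a i s) = 0" if "i < Suc n" for i
    proof (cases "i = n")
      case True
      then show ?thesis using p unfolding split t_def by simp
    next
      case False
      with that have "i < n" by simp
      with l have "0 = (\<Sum>s\<in>S - {p}. l s * b i s)" by simp
      also have "\<dots> = (\<Sum>s\<in>S - {p}. l s * a i s) - (\<Sum>s\<in>S - {p}. l s * a n s) * (a i p / a n p)"
        unfolding b_def sum_distrib_right sum_subtractf [symmetric]
        by (intro sum.cong) (auto simp: algebra_simps)
      finally show ?thesis unfolding split t_def by simp
    qed
    moreover have "\<exists>s\<in>S. l' s \<noteq> 0"
      using l(1) unfolding l'_def by auto
    ultimately show ?thesis by blast
  qed
qed

text \<open>A nontrivial solution \<open>l\<close> of \<open>\<Sum> l s = 0\<close> and \<open>\<Sum> l s p s = 0\<close> shows that the set of points with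
  \<open>l s > 0\<close> cannot be cut out by a halfspace.\<close>

lemma card_shattered_by_halfspaces:
  fixes p :: "'s \<Rightarrow> nat \<Rightarrow> real"
  assumes "finite Y"
    and F: "\<And>A. A \<in> F \<Longrightarrow> \<exists>r c. \<forall>s\<in>Y. s \<in> A \<longleftrightarrow> (\<Sum>i<d. r i * p s i) + c > 0"
    and sh: "shatters F Y"
  shows "card Y \<le> Suc d"
proof (rule ccontr)
  assume "\<not> card Y \<le> Suc d"
  then have "Suc d < card Y" by simp
  from homogeneous_system_nontrivial_solution[OF assms(1) this, of "\<lambda>i s. if i < d then p s i else 1"]
  obtain l0 where l0: "\<exists>s\<in>Y. l0 s \<noteq> 0"
    "\<And>i. i < Suc d \<Longrightarrow> (\<Sum>s\<in>Y. l0 s * (if i < d then p s i else 1)) = 0" by blast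
  \<comment> \<open>The system is invariant under negation, so a positive entry can be assumed. The
    equation with index \<open>d\<close>, whose coefficients are all 1, says that the entries sum to
    0.\<close>
  obtain l where l: "\<exists>s\<in>Y. l s > 0"
    "\<And>i. i < Suc d \<Longrightarrow> (\<Sum>s\<in>Y. l s * (if i < d then p s i else 1)) = 0"
  proof (cases "\<exists>s\<in>Y. l0 s > 0")
    case True
    then show ?thesis using l0(2) that by blast
  next
    case False
    then have "\<exists>s\<in>Y. - l0 s > 0" using l0(1) by force
    moreover have "(\<Sum>s\<in>Y. - l0 s * (if i < d then p s i else 1)) = 0" if "i < Suc d" for i
      using l0(2)[OF that] by (simp add: sum_negf)
    ultimately show ?thesis by (rule that)
  qed
  have lp: "(\<Sum>s\<in>Y. l s * p s i) = 0" if "i < d" for i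
    using l(2)[of i] that by simp
  have l1: "(\<Sum>s\<in>Y. l s) = 0"
    using l(2)[of d] by simp
  have "{s\<in>Y. l s > 0} \<subseteq> Y" by auto
  with sh obtain A where A: "A \<in> F" "A \<inter> Y = {s\<in>Y. l s > 0}"
    unfolding shatters_def by blast
  from F[OF A(1)] obtain r c where rc: "\<And>s. s \<in> Y \<Longrightarrow> s \<in> A \<longleftrightarrow> (\<Sum>i<d. r i * p s i) + c > 0"
    by blast
  define w where "w s = (\<Sum>i<d. r i * p s i) + c" for s
  have sgn: "l s > 0 \<longleftrightarrow> w s > 0" if "s \<in> Y" for s
    using rc[OF that] A(2) that unfolding w_def by blast
  have "(\<Sum>s\<in>Y. l s * w s) = (\<Sum>s\<in>Y. \<Sum>i<d. r i * (l s * p s i)) + (\<Sum>s\<in>Y. l s) * c"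
    unfolding w_def sum_distrib_right sum.distrib [symmetric]
    by (intro sum.cong) (auto simp: algebra_simps sum_distrib_left)
  also have "(\<Sum>s\<in>Y. \<Sum>i<d. r i * (l s * p s i)) = (\<Sum>i<d. r i * (\<Sum>s\<in>Y. l s * p s i))"
    by (subst sum.swap) (simp add: sum_distrib_left)
  also have "\<dots> = 0" using lp by simp
  finally have 0: "(\<Sum>s\<in>Y. l s * w s) = 0" using l1 by simp
  \<comment> \<open>\<open>l s\<close> and \<open>w s\<close> are positive at the same points of
    \<open>Y\<close>, so no term of the vanishing sum is negative, while a positive entry of
    \<open>l\<close> gives a positive term.\<close>
  have nonneg: "l s * w s \<ge> 0" if "s \<in> Y" for s
    using sgn[OF that] by (cases "l s > 0") (auto intro: mult_nonpos_nonpos simp: not_less)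
  from l(1) obtain s where s: "s \<in> Y" "l s > 0" by blast
  have "l s * w s > 0" using s sgn by auto
  moreover have "l s * w s = 0"
    using 0 nonneg s(1) assms(1) by (simp add: sum_nonneg_eq_0_iff)
  ultimately show False by simp
qed

text \<open>Whether \<open>h\<close> errs on a bag depends only on its labels at the
  \<open>q\<close> points of that bag. The trace on the bags is therefore a function of the trace on
  \<open>S \<times> {..<q}\<close>, where at most \<open>d + 1\<close> indices can be
  shattered.\<close>

lemma card_bag_traces_le:
  fixes B :: "'i \<Rightarrow> nat \<Rightarrow> nat \<Rightarrow> real" and x :: real
  assumes "finite S" "\<And>h. h \<in> H \<Longrightarrow> is_ltf d h" "0 < x" "x \<le> 1"
  shows "real (card ((\<lambda>h. {s\<in>S. bag_avg h q (B s) \<noteq> a}) ` H)) \<le> (1 / x) ^ Suc d * exp (x * (q * card S))"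
proof -
  define X where "X = S \<times> {..<q}"
  define tr where "tr h = {(s,t)\<in>X. h (B s t) = (1::real)}" for h
  define g where "g A = {s\<in>S. (\<Sum>t<q. if (s,t) \<in> A then 1 else 0) / real q \<noteq> a}" for A
  have finX: "finite X" using assms unfolding X_def by auto
  have fintr: "finite (tr ` H)"
    by (rule finite_subset[of _ "Pow X"]) (use finX in \<open>auto simp: tr_def\<close>)
  have "{s\<in>S. bag_avg h q (B s) \<noteq> a} = g (tr h)" if "h \<in> H" for h
  proof -
    obtain r c where h: "h = ltf d r c" using assms(2) \<open>h \<in> H\<close> unfolding is_ltf_def by blast
    have "(if (s, t) \<in> tr h then 1 else 0) = h (B s t)" if "s \<in> S" "t < q" for s t
      using that unfolding tr_def X_def h ltf_def by auto
    then show ?thesis unfolding g_def bag_avg_def by auto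
  qed
  then have "(\<lambda>h. {s\<in>S. bag_avg h q (B s) \<noteq> a}) ` H = g ` tr ` H"
    by (auto simp: image_iff)
  then have "card ((\<lambda>h. {s\<in>S. bag_avg h q (B s) \<noteq> a}) ` H) \<le> card (tr ` H)"
    using card_image_le[OF fintr] by simp
  also have "real (card (tr ` H)) \<le> (1 / x) ^ Suc d * exp (x * card X)"
  proof (rule card_le_of_no_large_shattered)
    fix Y assume Y: "Y \<subseteq> X" "shatters (tr ` H) Y"
    show "card Y \<le> Suc d"
    proof (rule card_shattered_by_halfspaces[where p = "\<lambda>(s,t). B s t" and F = "tr ` H"])
      fix A assume "A \<in> tr ` H"
      then obtain h where h: "h \<in> H" "A = tr h" by blast
      obtain r c where "h = ltf d r c" using assms(2)[OF h(1)] unfolding is_ltf_def by blast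
      with h Y(1) show "\<exists>r c. \<forall>s\<in>Y. s \<in> A \<longleftrightarrow> (\<Sum>i<d. r i * (case s of (s, t) \<Rightarrow> B s t) i) + c > 0"
        by (intro exI[of _ r] exI[of _ c]) (auto simp: tr_def ltf_def split: if_splits)
    qed (use Y finX finite_subset in auto)
  qed (use assms finX in \<open>auto simp: tr_def\<close>)
  finally show ?thesis
    unfolding X_def by (simp add: mult_ac card_cartesian_product)
qed

text \<open>Greedy choice: some element of \<open>K\<close> hits at least an \<open>\<eta>\<close>-fraction of the sets not hit so far.\<close>

lemma exists_small_hitting_set:
  fixes \<eta> :: real
  assumes "finite K" "finite P" "\<And>p. p \<in> P \<Longrightarrow> R p \<subseteq> K \<and> \<eta> * card K \<le> card (R p)"
    and "0 \<le> \<eta>" "\<eta> \<le> 1" "K \<noteq> {}"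
  shows "\<exists>S\<subseteq>K. card S \<le> n \<and> card {p\<in>P. R p \<inter> S = {}} \<le> (1 - \<eta>) ^ n * card P"
proof (induction n)
  case 0
  show ?case by (intro exI[of _ "{}"]) auto
next
  case (Suc n)
  then obtain S where S: "S \<subseteq> K" "card S \<le> n" "card {p\<in>P. R p \<inter> S = {}} \<le> (1 - \<eta>) ^ n * card P"
    by blast
  define Q where "Q = {p\<in>P. R p \<inter> S = {}}"
  have finQ: "finite Q" using assms unfolding Q_def by auto
  have "\<exists>k\<in>K. \<eta> * card Q \<le> card {p\<in>Q. k \<in> R p}"
  proof (rule ccontr)
    assume neg: "\<not> ?thesis"
    \<comment> \<open>Double counting of the incidences \<open>k \<in> R p\<close> contradicts that
      each \<open>R p\<close> fills an \<open>\<eta>\<close>-fraction of \<open>K\<close>.\<close>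
    have "(\<Sum>k\<in>K. real (card {p\<in>Q. k \<in> R p})) < (\<Sum>k\<in>K. \<eta> * card Q)"
      using neg assms by (intro sum_strict_mono) (auto simp: not_le)
    also have "\<dots> = (\<Sum>p\<in>Q. \<eta> * card K)" by simp
    also have "\<dots> \<le> (\<Sum>p\<in>Q. real (card (R p)))"
      using assms(3) unfolding Q_def by (intro sum_mono) auto
    also have "\<dots> = (\<Sum>p\<in>Q. \<Sum>k\<in>K. if k \<in> R p then 1 else 0)"
    proof (rule sum.cong)
      fix p assume "p \<in> Q"
      then have "R p = {k\<in>K. k \<in> R p}" using assms(3) unfolding Q_def by blast
      then show "real (card (R p)) = (\<Sum>k\<in>K. if k \<in> R p then 1 else 0)"
        using assms(1) by (simp add: sum.If_cases Int_def)
    qed simp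
    also have "\<dots> = (\<Sum>k\<in>K. real (card {p\<in>Q. k \<in> R p}))"
      using finQ by (subst sum.swap) (simp add: sum.If_cases Int_def)
    finally show False by simp
  qed
  then obtain k where k: "k \<in> K" "\<eta> * card Q \<le> card {p\<in>Q. k \<in> R p}" by blast
  have "real (card {p\<in>P. R p \<inter> insert k S = {}}) = card (Q - {p\<in>Q. k \<in> R p})"
    unfolding Q_def by (intro arg_cong[where f = "\<lambda>A. real (card A)"]) auto
  also have "\<dots> = real (card Q) - card {p\<in>Q. k \<in> R p}"
    using finQ by (subst card_Diff_subset) (auto simp: of_nat_diff card_mono)
  also have "\<dots> \<le> (1 - \<eta>) * card Q" using k by (simp add: algebra_simps)
  also have "\<dots> \<le> (1 - \<eta>) * ((1 - \<eta>) ^ n * card P)"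
    using S(3) assms unfolding Q_def by (intro mult_left_mono) auto
  finally have "card {p\<in>P. R p \<inter> insert k S = {}} \<le> (1 - \<eta>) ^ Suc n * card P" by simp
  moreover have "card (insert k S) \<le> Suc n"
    using S(2) finite_subset[OF S(1) assms(1)] by (simp add: card_insert_if)
  ultimately show ?case using S k by (intro exI[of _ "insert k S"]) auto
qed

text \<open>With \<open>x = \<eta> / (8 q)\<close> in the growth bound, the term \<open>x q n\<close> costs only a quarter of \<open>ln N\<close> when
  \<open>n \<approx> 2 ln N / \<eta>\<close>, which can be absorbed on the left-hand side.\<close>

lemma ln_packing_number_le:
  fixes \<eta> :: real and q :: nat
  assumes "finite K" "K \<noteq> {}" "T \<subseteq> Pow K" "T \<noteq> {}"
    and sep: "\<And>A B. A \<in> T \<Longrightarrow> B \<in> T \<Longrightarrow> A \<noteq> B \<Longrightarrow> \<eta> * card K \<le> card ((A - B) \<union> (B - A))"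
    and growth: "\<And>S (x::real). S \<subseteq> K \<Longrightarrow> 0 < x \<Longrightarrow> x \<le> 1 \<Longrightarrow>
        real (card ((\<lambda>A. A \<inter> S) ` T)) \<le> (1 / x) ^ D * exp (x * (q * card S))"
    and "0 < \<eta>" "\<eta> \<le> 1" "1 \<le> q" "1 \<le> D"
  shows "ln (card T) \<le> 3 / 2 * D * ln (8 * q / \<eta>)"
proof -
  define N where "N = real (card T)"
  have finT: "finite T" using assms by (meson finite_Pow_iff finite_subset)
  have N1: "N \<ge> 1" unfolding N_def using finT assms(4) by (simp add: Suc_leI card_gt_0_iff)
  define P where "P = {(A,B)\<in>T\<times>T. A \<noteq> B}"
  have finP: "finite P" unfolding P_def using finT by (auto intro: finite_subset[of _ "T \<times> T"])
  have "card P < card (T \<times> T)"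
    using assms(4) finT unfolding P_def by (intro psubset_card_mono) auto
  then have cardP: "real (card P) < N\<^sup>2"
    unfolding N_def card_cartesian_product power2_eq_square by (metis of_nat_less_iff of_nat_mult)
  \<comment> \<open>This length gives \<open>(1 - \<eta>) ^ n \<le> 1 / N\<^sup>2\<close>. As there
    are fewer than \<open>N\<^sup>2\<close> pairs, fewer than one pair, hence none, is left
    unhit.\<close>
  define n where "n = nat \<lceil>2 * ln N / \<eta>\<rceil>"
  have lnN: "ln N \<ge> 0" using N1 by simp
  have n1: "2 * ln N \<le> \<eta> * n"
    using assms(7) of_nat_ceiling[of "2 * ln N / \<eta>"] unfolding n_def by (simp add: field_simps)
  have "real n \<le> 2 * ln N / \<eta> + 1"
    unfolding n_def using lnN assms(7) by simp
  then have n2: "\<eta> * n \<le> 2 * ln N + 1"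
    using assms(7,8) mult_left_mono[of "real n" "2 * ln N / \<eta> + 1" \<eta>] by (simp add: field_simps)
  have R: "(\<lambda>(A,B). (A - B) \<union> (B - A)) p \<subseteq> K \<and> \<eta> * card K \<le> card ((\<lambda>(A,B). (A - B) \<union> (B - A)) p)"
    if "p \<in> P" for p
  proof -
    obtain A B where "p = (A, B)" "A \<in> T" "B \<in> T" "A \<noteq> B" using \<open>p \<in> P\<close> unfolding P_def by blast
    with sep[of A B] assms(3) show ?thesis by auto
  qed
  have "\<exists>S\<subseteq>K. card S \<le> n \<and>
      card {p\<in>P. (\<lambda>(A,B). (A - B) \<union> (B - A)) p \<inter> S = {}} \<le> (1 - \<eta>) ^ n * card P"
    by (rule exists_small_hitting_set[OF assms(1) finP R]) (use assms(2,7,8) in simp_all)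
  then
  obtain S where S: "S \<subseteq> K" "card S \<le> n"
    "card {p\<in>P. (\<lambda>(A,B). (A - B) \<union> (B - A)) p \<inter> S = {}} \<le> (1 - \<eta>) ^ n * card P"
    by blast
  have "(1 - \<eta>) ^ n \<le> exp (- \<eta>) ^ n"
    by (rule power_mono) (use assms exp_ge_add_one_self[of "- \<eta>"] in auto)
  also have "\<dots> \<le> exp (- (2 * ln N))"
    using n1 by (simp add: exp_of_nat_mult [symmetric] mult.commute)
  also have "\<dots> = 1 / N\<^sup>2"
    using N1 by (simp add: exp_minus exp_double divide_inverse)
  finally have "(1 - \<eta>) ^ n * card P \<le> 1 / N\<^sup>2 * card P"
    by (rule mult_right_mono) simp
  also have "\<dots> < 1" using cardP N1 by (simp add: field_simps)
  finally have "card {p\<in>P. (\<lambda>(A,B). (A - B) \<union> (B - A)) p \<inter> S = {}} = 0" using S(3) by linarith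
  then have empty: "{p\<in>P. (\<lambda>(A,B). (A - B) \<union> (B - A)) p \<inter> S = {}} = {}"
    using finP by simp
  \<comment> \<open>Every symmetric difference meets \<open>S\<close>, so distinct members of
    \<open>T\<close> keep distinct traces there and the growth bound on \<open>S\<close> controls
    \<open>N\<close> itself.\<close>
  have "inj_on (\<lambda>A. A \<inter> S) T"
  proof (rule inj_onI, rule ccontr)
    fix A B assume AB: "A \<in> T" "B \<in> T" "A \<inter> S = B \<inter> S" "A \<noteq> B"
    then have "(A, B) \<in> {p\<in>P. (\<lambda>(A,B). (A - B) \<union> (B - A)) p \<inter> S = {}}"
      unfolding P_def by auto
    with empty show False by blast
  qed
  then have "N = card ((\<lambda>A. A \<inter> S) ` T)" unfolding N_def by (simp add: card_image)
  also have "\<dots> \<le> (1 / (\<eta> / (8 * real q))) ^ D * exp (\<eta> / (8 * real q) * (q * card S))"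
    using growth[OF S(1), of "\<eta> / (8 * real q)"] assms(7-9) by (simp add: divide_le_eq)
  also have "\<eta> / (8 * real q) * (q * card S) = \<eta> * card S / 8" using assms(9) by simp
  also have "1 / (\<eta> / (8 * real q)) = 8 * q / \<eta>" by simp
  finally have N_le: "N \<le> (8 * q / \<eta>) ^ D * exp (\<eta> * card S / 8)" .
  define l where "l = ln (8 * q / \<eta>)"
  have qe: "8 * q / \<eta> \<ge> 8"
    using assms(7-9) by (simp add: le_divide_eq)
  have "exp 1 \<le> (8::real)" using exp_le by simp
  then have "l \<ge> 1" unfolding l_def using qe by (subst ln_ge_iff) auto
  then have Dl: "D * l \<ge> 1" using assms(10) mult_mono[of 1 "real D" 1 l] by simp
  have "ln N \<le> ln ((8 * q / \<eta>) ^ D * exp (\<eta> * card S / 8))"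
    using N_le N1 by (intro ln_mono) auto
  also have "\<dots> = D * l + \<eta> * card S / 8"
    using qe by (subst ln_mult) (auto simp: ln_realpow l_def)
  also have "\<dots> \<le> D * l + (2 * ln N + 1) / 8"
  proof -
    have "\<eta> * card S \<le> \<eta> * n" using S(2) assms(7) by simp
    then show ?thesis using n2 by simp
  qed
  \<comment> \<open>The term \<open>ln N / 4\<close> moves to the left and
    \<open>1 / 8 \<le> D * l / 8\<close>, so \<open>3/4 * ln N \<le> 9/8 * (D * l)\<close>.\<close>
  finally have "ln N \<le> 3 / 2 * (D * l)" using Dl by argo
  then show ?thesis unfolding N_def l_def by simp
qed

section \<open>Chaining for Rademacher sums\<close>

text \<open>This is \<open>cosh x \<le> exp (x\<^sup>2 / 2)\<close>. For \<open>x \<ge> 0\<close> it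
  comes from the analytic core of Hoeffding's lemma at probability 1/2 and argument
  \<open>2 * x\<close>; negative \<open>x\<close> follow by symmetry.\<close>

lemma exp_plus_exp_minus_le:
  fixes x :: real
  shows "exp x + exp (- x) \<le> 2 * exp (x\<^sup>2 / 2)"
proof -
  have *: "exp x + exp (- x) \<le> 2 * exp (x\<^sup>2 / 2)" if "x \<ge> 0" for x :: real
  proof -
    have pos: "1 + 1/2 * (exp (2 * x) - 1) > (0::real)"
      by (simp add: field_simps add_pos_pos)
    have "- (2 * x) * (1/2) + ln (1 + 1/2 * (exp (2 * x) - 1)) \<le> (2 * x)\<^sup>2 / 8"
      using that by (intro Hoeffdings_lemma_aux) auto
    then have "ln (1 + 1/2 * (exp (2 * x) - 1)) \<le> x + x\<^sup>2 / 2"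
      by (simp add: power2_eq_square)
    then have "1 + 1/2 * (exp (2 * x) - 1) \<le> exp (x + x\<^sup>2 / 2)"
      using pos by (metis exp_le_cancel_iff exp_ln)
    then have "exp (- x) * (2 + (exp (2 * x) - 1)) \<le> exp (- x) * (2 * exp (x + x\<^sup>2 / 2))"
      by (intro mult_left_mono) (argo, simp)
    then show ?thesis
      by (simp add: distrib_left right_diff_distrib exp_add [symmetric] mult.left_commute)
  qed
  show ?thesis
    using *[of "\<bar>x\<bar>"] by (cases "x \<ge> 0") (auto simp: abs_if add.commute)
qed

text \<open>A Rademacher sum whose signs are encoded by the set \<open>S\<close> of indices with
  sign -1. Uniform random signs correspond to counting subsets of \<open>I\<close>, so probabilities
  become cardinalities divided by \<open>2 ^ card I\<close>.\<close>

definition signed_sum :: "'i set \<Rightarrow> 'i set \<Rightarrow> ('i \<Rightarrow> real) \<Rightarrow> real" where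
  "signed_sum I S u = (\<Sum>i\<in>I. if i \<in> S then - u i else u i)"

lemma signed_sum_diff: "signed_sum I S (\<lambda>i. u i - v i) = signed_sum I S u - signed_sum I S v"
  unfolding signed_sum_def sum_subtractf [symmetric] by (intro sum.cong) auto

text \<open>Hoeffding's bound in counting form: after an exponential Markov inequality the sum over
  all sign patterns factorizes over \<open>I\<close>, and each factor is bounded as a hyperbolic
  cosine.\<close>

lemma card_signed_sum_gt_le:
  assumes "finite I" "(\<Sum>i\<in>I. (u i)\<^sup>2) \<le> V" "V > 0" "s \<ge> 0"
  shows "card {S\<in>Pow I. signed_sum I S u > s} \<le> 2 ^ card I * exp (- s\<^sup>2 / (2 * V))"
proof -
  \<comment> \<open>The minimizer of the exponent \<open>l\<^sup>2 / 2 * V - l * s\<close>.\<close>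
  define l where "l = s / V"
  have l: "l \<ge> 0" using assms unfolding l_def by simp
  let ?Z = "{S\<in>Pow I. signed_sum I S u > s}"
  have "card ?Z * exp (l * s) = (\<Sum>S\<in>?Z. exp (l * s))" by simp
  also have "\<dots> \<le> (\<Sum>S\<in>?Z. exp (l * signed_sum I S u))"
    using l by (intro sum_mono) (auto intro: mult_left_mono)
  also have "\<dots> \<le> (\<Sum>S\<in>Pow I. exp (l * signed_sum I S u))"
    using assms by (intro sum_mono2) auto
  also have "\<dots> = (\<Sum>S\<in>Pow I. (\<Prod>i\<in>S. exp (- (l * u i))) * (\<Prod>i\<in>I - S. exp (l * u i)))"
  proof (rule sum.cong)
    fix S assume "S \<in> Pow I"
    then have "signed_sum I S u = (\<Sum>i\<in>S. - u i) + (\<Sum>i\<in>I - S. u i)"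
      unfolding signed_sum_def using assms(1)
      by (subst sum.If_cases) (auto simp: Int_absorb1 Diff_eq)
    then show "exp (l * signed_sum I S u) = (\<Prod>i\<in>S. exp (- (l * u i))) * (\<Prod>i\<in>I - S. exp (l * u i))"
      using \<open>S \<in> Pow I\<close> assms(1)
      by (simp add: distrib_left exp_add sum_distrib_left exp_sum finite_subset flip: exp_sum sum_negf)
  qed simp
  also have "\<dots> = (\<Prod>i\<in>I. exp (- (l * u i)) + exp (l * u i))"
    using assms by (simp add: prod_add)
  also have "\<dots> \<le> (\<Prod>i\<in>I. 2 * exp ((l * u i)\<^sup>2 / 2))"
    using exp_plus_exp_minus_le by (intro prod_mono) (auto simp: add.commute intro: add_nonneg_nonneg)
  also have "\<dots> = 2 ^ card I * exp (l\<^sup>2 / 2 * (\<Sum>i\<in>I. (u i)\<^sup>2))"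
    using assms by (simp add: prod.distrib exp_sum sum_distrib_left power_mult_distrib)
  also have "\<dots> \<le> 2 ^ card I * exp (l\<^sup>2 / 2 * V)"
    using assms by (intro mult_left_mono) (auto intro: mult_left_mono)
  finally have "card ?Z \<le> 2 ^ card I * (exp (l\<^sup>2 / 2 * V) / exp (l * s))"
    by (simp add: field_simps)
  also have "exp (l\<^sup>2 / 2 * V) / exp (l * s) = exp (l\<^sup>2 / 2 * V - l * s)" by (simp add: exp_diff)
  also have "l\<^sup>2 / 2 * V - l * s = - s\<^sup>2 / (2 * V)"
    using assms unfolding l_def by (simp add: field_simps power2_eq_square)
  finally show ?thesis .
qed

text \<open>Each \<open>A\<close> in \<open>T (Suc J)\<close> has a partner in \<open>T J\<close>.
  If its signed sum exceeds the total threshold, either the link to the partner exceeds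
  \<open>s (Suc J)\<close> or the partner already exceeds the sum of the earlier thresholds. Level
  \<open>j\<close> has one link per element of \<open>T j\<close>, so a union bound gives the
  \<open>j\<close>-th summand.\<close>

lemma card_chaining_le:
  fixes u :: "'a \<Rightarrow> 'i \<Rightarrow> real" and T :: "nat \<Rightarrow> 'a set"
  assumes "finite I" "\<And>j. finite (T j)" "\<And>j. V j > 0" "\<And>j. s j \<ge> 0"
    and base: "\<And>A. A \<in> T 0 \<Longrightarrow> (\<Sum>i\<in>I. (u A i)\<^sup>2) \<le> V 0"
    and link: "\<And>j A. A \<in> T (Suc j) \<Longrightarrow> \<exists>B\<in>T j. (\<Sum>i\<in>I. (u A i - u B i)\<^sup>2) \<le> V (Suc j)"
  shows "card {S\<in>Pow I. \<exists>A\<in>T J. signed_sum I S (u A) > (\<Sum>j\<le>J. s j)}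
    \<le> 2 ^ card I * (\<Sum>j\<le>J. card (T j) * exp (- (s j)\<^sup>2 / (2 * V j)))"
proof -
  have union: "real (card (\<Union>A\<in>T j. {S\<in>Pow I. signed_sum I S (w A) > s j}))
      \<le> 2 ^ card I * (card (T j) * exp (- (s j)\<^sup>2 / (2 * V j)))"
    if "\<And>A. A \<in> T j \<Longrightarrow> (\<Sum>i\<in>I. (w A i)\<^sup>2) \<le> V j" for j and w :: "'a \<Rightarrow> 'i \<Rightarrow> real"
  proof -
    have "real (card (\<Union>A\<in>T j. {S\<in>Pow I. signed_sum I S (w A) > s j}))
      \<le> real (\<Sum>A\<in>T j. card {S\<in>Pow I. signed_sum I S (w A) > s j})"
      using assms by (intro of_nat_mono card_UN_le) auto
    also have "\<dots> = (\<Sum>A\<in>T j. real (card {S\<in>Pow I. signed_sum I S (w A) > s j}))" by simp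
    also have "\<dots> \<le> (\<Sum>A\<in>T j. 2 ^ card I * exp (- (s j)\<^sup>2 / (2 * V j)))"
      using assms that by (intro sum_mono card_signed_sum_gt_le) auto
    finally show ?thesis by (simp add: mult_ac)
  qed
  show ?thesis
  proof (induction J)
    case 0
    have "{S\<in>Pow I. \<exists>A\<in>T 0. signed_sum I S (u A) > (\<Sum>j\<le>0. s j)}
        = (\<Union>A\<in>T 0. {S\<in>Pow I. signed_sum I S (u A) > s 0})" by auto
    with union[of 0 u] base show ?case by simp
  next
    case (Suc J)
    obtain p where p: "\<And>A. A \<in> T (Suc J) \<Longrightarrow> p A \<in> T J"
      "\<And>A. A \<in> T (Suc J) \<Longrightarrow> (\<Sum>i\<in>I. (u A i - u (p A) i)\<^sup>2) \<le> V (Suc J)"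
      using link[of _ J] by metis
    define X where "X = {S\<in>Pow I. \<exists>A\<in>T J. signed_sum I S (u A) > (\<Sum>j\<le>J. s j)}"
    define Y where "Y = (\<Union>A\<in>T (Suc J). {S\<in>Pow I. signed_sum I S (\<lambda>i. u A i - u (p A) i) > s (Suc J)})"
    have fin: "finite X" "finite Y" using assms unfolding X_def Y_def by auto
    have "{S\<in>Pow I. \<exists>A\<in>T (Suc J). signed_sum I S (u A) > (\<Sum>j\<le>Suc J. s j)} \<subseteq> X \<union> Y"
    proof clarify
      fix S A assume S: "S \<subseteq> I" "A \<in> T (Suc J)" "signed_sum I S (u A) > (\<Sum>j\<le>Suc J. s j)" "S \<notin> Y"
      then have "signed_sum I S (u (p A)) > (\<Sum>j\<le>J. s j)"
        unfolding Y_def signed_sum_diff by (auto simp: not_less)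
      with S p show "S \<in> X" unfolding X_def by auto
    qed
    then have "card {S\<in>Pow I. \<exists>A\<in>T (Suc J). signed_sum I S (u A) > (\<Sum>j\<le>Suc J. s j)} \<le> card (X \<union> Y)"
      using fin by (intro card_mono) auto
    also have "\<dots> \<le> card X + card Y" by (rule card_Un_le)
    finally have "real (card {S\<in>Pow I. \<exists>A\<in>T (Suc J). signed_sum I S (u A) > (\<Sum>j\<le>Suc J. s j)})
        \<le> real (card X) + card Y" by linarith
    also have "\<dots> \<le> 2 ^ card I * (\<Sum>j\<le>J. card (T j) * exp (- (s j)\<^sup>2 / (2 * V j)))
        + 2 ^ card I * (card (T (Suc J)) * exp (- (s (Suc J))\<^sup>2 / (2 * V (Suc J))))"
      unfolding X_def Y_def by (intro add_mono Suc.IH union p(2))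
    finally show ?case by (simp add: distrib_left)
  qed
qed

section \<open>Nets and the multiscale estimate\<close>

text \<open>Greedy construction: a set farther than \<open>\<eta>\<close> from the current net is
  added, any other is already covered. Separation will bound the size of the net, and covering will
  provide the links for chaining.\<close>

lemma exists_net:
  fixes \<eta> :: real
  assumes "finite F" "\<eta> \<ge> 0"
  shows "\<exists>T\<subseteq>F. (\<forall>A\<in>T. \<forall>B\<in>T. A \<noteq> B \<longrightarrow> \<eta> < card ((A - B) \<union> (B - A))) \<and>
    (\<forall>A\<in>F. \<exists>B\<in>T. card ((A - B) \<union> (B - A)) \<le> \<eta>)"
  using assms
proof (induction F rule: finite_induct)
  case empty
  show ?case by auto
next
  case (insert X F)
  then obtain T where T: "T \<subseteq> F" "\<forall>A\<in>T. \<forall>B\<in>T. A \<noteq> B \<longrightarrow> \<eta> < card ((A - B) \<union> (B - A))"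
    "\<forall>A\<in>F. \<exists>B\<in>T. card ((A - B) \<union> (B - A)) \<le> \<eta>" by blast
  show ?case
  proof (cases "\<exists>B\<in>T. card ((X - B) \<union> (B - X)) \<le> \<eta>")
    case True
    with T show ?thesis by (intro exI[of _ T]) auto
  next
    case False
    with T insert.prems show ?thesis
      by (intro exI[of _ "insert X T"]) (auto simp: not_le Un_commute)
  qed
qed

text \<open>Bag \<open>(i, False)\<close> is the \<open>i\<close>-th bag of the sample and \<open>(i, True)\<close> the \<open>i\<close>-th bag of the ghost sample.\<close>

definition pair_diff :: "(nat \<times> bool) set \<Rightarrow> nat \<Rightarrow> real" where
  "pair_diff A i = of_bool ((i, True) \<in> A) - of_bool ((i, False) \<in> A)"

lemma sum_pair_diff_sq_le: "(\<Sum>i<m. (pair_diff A i)\<^sup>2) \<le> m"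
proof -
  have "(\<Sum>i<m. (pair_diff A i)\<^sup>2) \<le> (\<Sum>i<m. 1)"
    by (intro sum_mono) (auto simp: pair_diff_def)
  then show ?thesis by simp
qed

text \<open>Passing from \<open>B\<close> to \<open>A\<close> changes the \<open>i\<close>-th
  difference by at most the number \<open>e \<le> 2\<close> of bags of pair \<open>i\<close> in the
  symmetric difference, and \<open>e\<^sup>2 \<le> 2 * e\<close>.\<close>

lemma sum_pair_diff_diff_sq_le:
  assumes "A \<subseteq> {..<m} \<times> UNIV" "B \<subseteq> {..<m} \<times> UNIV"
  shows "(\<Sum>i<m. (pair_diff A i - pair_diff B i)\<^sup>2) \<le> 2 * real (card ((A - B) \<union> (B - A)))"
proof -
  let ?E = "(A - B) \<union> (B - A)"
  have "(\<Sum>i<m. (pair_diff A i - pair_diff B i)\<^sup>2) \<le> (\<Sum>i<m. 2 * (\<Sum>b\<in>UNIV. of_bool ((i, b) \<in> ?E)))"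
    by (intro sum_mono) (auto simp: pair_diff_def UNIV_bool)
  also have "\<dots> = 2 * (\<Sum>k\<in>{..<m} \<times> UNIV. of_bool (k \<in> ?E))"
    by (simp add: sum_distrib_left sum.cartesian_product case_prod_beta)
  also have "(\<Sum>k\<in>{..<m} \<times> (UNIV::bool set). of_bool (k \<in> ?E)) = real (card (({..<m} \<times> UNIV) \<inter> ?E))"
    by (simp add: of_bool_def sum.If_cases Int_def)
  also have "({..<m} \<times> UNIV) \<inter> ?E = ?E" using assms by auto
  finally show ?thesis .
qed


lemma sum_half_powers_le: "(\<Sum>j\<le>J. (1/2::real) ^ j) \<le> 2"
proof -
  have "(\<Sum>j\<le>J. (1/2::real) ^ j) = 2 - (1/2) ^ J"
    by (induction J) auto
  then show ?thesis by simp
qed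

text \<open>On the left are the costs at level \<open>j\<close>: \<open>12 + 6 * j\<close> for the
  size of the net and \<open>4 + 4 * j\<close> for the failure probability. The right side grows by
  a factor 4 per level, because the squared thresholds shrink by 4 and the variances by 16.\<close>

lemma chaining_exponent_le: "16 + 10 * real j \<le> (if j = 0 then 40 else 10 * 4 ^ j)"
proof (cases j)
  case (Suc i)
  have "26 + 10 * real i \<le> 40 * 4 ^ i"
  proof (induction i)
    case (Suc i)
    have "(1::real) \<le> 4 ^ i" by simp
    with Suc show ?case by simp
  qed simp
  with Suc show ?thesis by simp
qed simp

text \<open>The chaining bound for nets whose radius is the fraction \<open>\<eta> j\<close> of the
  \<open>2 * m\<close> bags. The thresholds add up to at most \<open>4/5 * m * \<epsilon>\<close>
  and the failure probabilities to at most \<open>\<delta> / 2\<close>.\<close>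

lemma card_signed_pair_diff_gt_le:
  fixes \<epsilon> \<delta> :: real and q m D :: nat
  assumes F: "F \<subseteq> Pow ({..<m} \<times> UNIV)"
    and growth: "\<And>S (x::real). S \<subseteq> {..<m} \<times> UNIV \<Longrightarrow> 0 < x \<Longrightarrow> x \<le> 1 \<Longrightarrow>
        real (card ((\<lambda>A. A \<inter> S) ` F)) \<le> (1 / x) ^ D * exp (x * (q * card S))"
    and "2 \<le> q" "1 \<le> D" "1 \<le> m" "0 < \<epsilon>" "0 < \<delta>" "\<delta> < 1"
    and m: "m * \<epsilon>\<^sup>2 \<ge> 500 * D * (ln q + ln (1 / \<delta>))"
  shows "card {S\<in>Pow {..<m}. \<exists>A\<in>F. signed_sum {..<m} S (pair_diff A) > 4/5 * m * \<epsilon>}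
    \<le> 2 ^ m * (\<delta> / 2)"
proof -
  define L where "L = ln q + ln (1 / \<delta>)"
  define K where "K = {..<m} \<times> (UNIV :: bool set)"
  have K: "finite K" "K \<noteq> {}" "card K = 2 * m"
    using assms(5) unfolding K_def by (auto simp: card_cartesian_product lessThan_empty_iff)
  have finF: "finite F" using F K(1) unfolding K_def by (meson finite_Pow_iff finite_subset)
  define \<eta> :: "nat \<Rightarrow> real" where "\<eta> j = (1/16) ^ Suc j" for j
  have \<eta>: "0 < \<eta> j" "\<eta> j \<le> 1" for j
    unfolding \<eta>_def by (simp, intro power_le_one, simp_all)
  have "\<exists>T\<subseteq>F. (\<forall>A\<in>T. \<forall>B\<in>T. A \<noteq> B \<longrightarrow> \<eta> j * card K < card ((A - B) \<union> (B - A))) \<and>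
    (\<forall>A\<in>F. \<exists>B\<in>T. card ((A - B) \<union> (B - A)) \<le> \<eta> j * card K)" for j
    using \<eta>[of j] by (intro exists_net finF) auto
  then obtain T where T: "\<And>j. T j \<subseteq> F"
    "\<And>j A B. A \<in> T j \<Longrightarrow> B \<in> T j \<Longrightarrow> A \<noteq> B \<Longrightarrow> \<eta> j * card K < card ((A - B) \<union> (B - A))"
    "\<And>j A. A \<in> F \<Longrightarrow> \<exists>B\<in>T j. card ((A - B) \<union> (B - A)) \<le> \<eta> j * card K"
    by metis
  have finT: "finite (T j)" for j using T(1) finF finite_subset by blast
  \<comment> \<open>Level 0 starts from the trivial variance bound \<open>m\<close>. A link from
    level \<open>j > 0\<close> goes to the net of level \<open>j - 1\<close>, at distance at most
    \<open>2 * m * \<eta> (j - 1)\<close>, and squared differences cost another factor 2.\<close>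
  define V where "V j = (if j = 0 then real m else 4 * m * \<eta> (j - 1))" for j
  define s where "s j = 2/5 * m * \<epsilon> * (1/2) ^ j" for j
  have lnq: "ln 2 \<le> ln (real q)" "0 < ln (real q)" using assms(3) by auto
  have Lq: "ln q \<le> L" unfolding L_def using assms(7,8) by simp
  have L0: "0 < L" using Lq lnq by linarith

  have cardT: "card (T j) \<le> exp ((12 + 6 * j) * (D * L))" for j
  proof (cases "T j = {}")
    case False
    have "ln (card (T j)) \<le> 3 / 2 * D * ln (8 * q / \<eta> j)"
    proof (rule ln_packing_number_le[OF K(1,2) _ False])
      show "T j \<subseteq> Pow K" using T(1) F unfolding K_def by blast
      fix S and x :: real assume S: "S \<subseteq> K" "0 < x" "x \<le> 1"
      have "card ((\<lambda>A. A \<inter> S) ` T j) \<le> card ((\<lambda>A. A \<inter> S) ` F)"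
        using finF T(1) by (intro card_mono finite_imageI image_mono) auto
      with growth[of S x] S show "real (card ((\<lambda>A. A \<inter> S) ` T j)) \<le> (1 / x) ^ D * exp (x * (q * card S))"
        unfolding K_def by simp
    next
      fix A B assume "A \<in> T j" "B \<in> T j" "A \<noteq> B"
      from T(2)[OF this] show "\<eta> j * card K \<le> card ((A - B) \<union> (B - A))" by simp
    qed (use \<eta> assms(3,4) in auto)
    also have "\<dots> \<le> 3 / 2 * D * ((8 + 4 * j) * ln q)"
    proof (rule mult_left_mono)
      \<comment> \<open>Since \<open>2 \<le> q\<close>, powers of 2 are absorbed into powers of
        \<open>q\<close>; the factor 3/2 of the packing bound turns \<open>8 + 4 * j\<close> into
        \<open>12 + 6 * j\<close>.\<close>
      have "8 * q / \<eta> j = 2 ^ (7 + 4 * j) * real q"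
        unfolding \<eta>_def by (simp add: power_divide power_add power_mult)
      then have "ln (8 * q / \<eta> j) = (7 + 4 * j) * ln 2 + ln q"
        using assms(3) by (simp add: ln_mult ln_realpow)
      also have "\<dots> \<le> (7 + 4 * j) * ln q + ln q"
        using lnq by (intro add_mono mult_left_mono) auto
      finally show "ln (8 * q / \<eta> j) \<le> (8 + 4 * j) * ln q" by (simp add: algebra_simps)
    qed simp
    also have "\<dots> = (12 + 6 * j) * (D * ln q)" by (simp add: field_simps)
    also have "\<dots> \<le> (12 + 6 * j) * (D * L)" using Lq by (intro mult_left_mono) auto
    finally have "exp (ln (card (T j))) \<le> exp ((12 + 6 * j) * (D * L))" by simp
    then show ?thesis using False finT by (simp add: card_gt_0_iff)
  qed simp
  \<comment> \<open>The constant 500 enters here: at level 0 the exponent is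
    \<open>2/25 * m * \<epsilon>\<^sup>2\<close>, which is 40 times
    \<open>m * \<epsilon>\<^sup>2 / 500\<close>, and the latter is at least
    \<open>D * L\<close>.\<close>
  have exponent: "(16 + 10 * j) * (D * L) \<le> (s j)\<^sup>2 / (2 * V j)" for j
  proof -
    have "(s j)\<^sup>2 / (2 * V j) = (if j = 0 then 40 else 10 * 4 ^ j) * (m * \<epsilon>\<^sup>2 / 500)"
    proof (cases j)
      case 0
      then show ?thesis using assms(5) unfolding s_def V_def by (simp add: power2_eq_square field_simps)
    next
      case (Suc i)
      have *: "((1/2::real) ^ Suc i)\<^sup>2 = (1/4) ^ Suc i"
        by (simp add: power2_eq_square flip: power_mult_distrib)
      have "(s j)\<^sup>2 / (2 * V j) = (2/5 * m * \<epsilon>)\<^sup>2 * (1/4) ^ Suc i / (8 * m * (1/16) ^ Suc i)"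
        unfolding s_def V_def \<eta>_def Suc by (simp only: power_mult_distrib * ) simp
      also have "\<dots> = (2/5 * m * \<epsilon>)\<^sup>2 / (8 * m) * ((1/4) / (1/16)) ^ Suc i"
        unfolding power_divide by simp
      also have "\<dots> = 10 * 4 ^ j * (m * \<epsilon>\<^sup>2 / 500)"
        using assms(5) unfolding Suc by (simp add: power2_eq_square)
      finally show ?thesis using Suc by simp
    qed
    moreover have "(16 + 10 * j) * (D * L) \<le> (if j = 0 then 40 else 10 * 4 ^ j) * (m * \<epsilon>\<^sup>2 / 500)"
      using m L0 chaining_exponent_le[of j] unfolding L_def [symmetric]
      by (intro mult_mono) auto
    ultimately show ?thesis by simp
  qed
  have fail: "card (T j) * exp (- (s j)\<^sup>2 / (2 * V j)) \<le> \<delta> / 4 * (1/2) ^ j" for j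
  proof -
    have "card (T j) * exp (- (s j)\<^sup>2 / (2 * V j))
        \<le> exp ((12 + 6 * j) * (D * L)) * exp (- ((16 + 10 * j) * (D * L)))"
      using exponent[of j] cardT[of j] by (intro mult_mono) auto
    also have "\<dots> = exp (- ((4 + 4 * j) * (D * L)))"
      by (simp flip: exp_add add: algebra_simps)
    also have "\<dots> \<le> exp (- ((2 + j) * L))"
    proof -
      have "(2 + j) * L \<le> (4 + 4 * j) * (D * L)"
        using L0 assms(4) by (intro mult_mono) auto
      then show ?thesis by simp
    qed
    also have "\<dots> = exp (- L) ^ (2 + j)"
      unfolding exp_of_nat_mult [symmetric] by simp
    also have "exp (- L) = \<delta> / q"
      unfolding L_def using assms(3,7) by (simp add: exp_minus exp_add ln_div exp_diff)
    \<comment> \<open>As \<open>2 \<le> q\<close>, the summand \<open>ln q\<close> of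
      \<open>L\<close> supplies the geometric factor that makes the levels summable, while one
      factor \<open>\<delta>\<close> is kept.\<close>
    also have "(\<delta> / q) ^ (2 + j) \<le> (\<delta> / 2) ^ (2 + j)"
      using assms(3,7) by (intro power_mono divide_left_mono) auto
    also have "\<dots> = \<delta> ^ (2 + j) * (1/4 * (1/2) ^ j)" by (simp add: power_divide power_add)
    also have "\<dots> \<le> \<delta> ^ 1 * (1/4 * (1/2) ^ j)"
      using assms(7,8) by (intro mult_right_mono power_decreasing) auto
    finally show ?thesis by simp
  qed

  \<comment> \<open>At level \<open>m\<close> the radius is less than one bag, so the net is all of
    \<open>F\<close> and the chain ends without a remainder.\<close>
  have "F \<subseteq> T m"
  proof
    fix A assume A: "A \<in> F"
    then obtain B where B: "B \<in> T m" "card ((A - B) \<union> (B - A)) \<le> \<eta> m * card K" using T(3) by blast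
    have "real m < 2 ^ m" by (rule of_nat_less_two_power)
    also have "\<dots> \<le> (16::real) ^ m" by (rule power_mono) auto
    also have "\<dots> \<le> 8 * 16 ^ m" by simp
    finally have "real m < 8 * 16 ^ m" .
    then have "\<eta> m * card K < 1"
      unfolding \<eta>_def K(3) by (simp add: field_simps)
    with B(2) have "card ((A - B) \<union> (B - A)) = 0" by linarith
    moreover have "(A - B) \<union> (B - A) \<subseteq> K" using A B(1) T(1) F unfolding K_def by blast
    ultimately have "(A - B) \<union> (B - A) = {}" using finite_subset[OF _ K(1)] by auto
    then have "A = B" by blast
    with B show "A \<in> T m" by simp
  qed
  moreover have "(\<Sum>j\<le>m. s j) \<le> 4/5 * m * \<epsilon>"
    using mult_left_mono[OF sum_half_powers_le[of m], of "2/5 * m * \<epsilon>"] assms(6)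
    unfolding s_def sum_distrib_left by simp
  ultimately have "{S\<in>Pow {..<m}. \<exists>A\<in>F. signed_sum {..<m} S (pair_diff A) > 4/5 * m * \<epsilon>}
      \<subseteq> {S\<in>Pow {..<m}. \<exists>A\<in>T m. signed_sum {..<m} S (pair_diff A) > (\<Sum>j\<le>m. s j)}"
    by (blast intro: le_less_trans)
  then have "real (card {S\<in>Pow {..<m}. \<exists>A\<in>F. signed_sum {..<m} S (pair_diff A) > 4/5 * m * \<epsilon>})
      \<le> card {S\<in>Pow {..<m}. \<exists>A\<in>T m. signed_sum {..<m} S (pair_diff A) > (\<Sum>j\<le>m. s j)}"
    by (intro of_nat_mono card_mono) auto
  also have "\<dots> \<le> 2 ^ card {..<m} * (\<Sum>j\<le>m. card (T j) * exp (- (s j)\<^sup>2 / (2 * V j)))"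
  proof (rule card_chaining_le[OF finite_lessThan finT])
    show "V j > 0" for j using \<eta> assms(5) unfolding V_def by simp
    show "s j \<ge> 0" for j using assms(6) unfolding s_def by simp
    show "(\<Sum>i<m. (pair_diff A i)\<^sup>2) \<le> V 0" for A
      unfolding V_def using sum_pair_diff_sq_le by simp
    fix j A assume A: "A \<in> T (Suc j)"
    then have "A \<in> F" using T(1) by blast
    then obtain B where B: "B \<in> T j" "card ((A - B) \<union> (B - A)) \<le> \<eta> j * card K" using T(3) by blast
    have "(\<Sum>i<m. (pair_diff A i - pair_diff B i)\<^sup>2) \<le> 2 * real (card ((A - B) \<union> (B - A)))"
      using \<open>A \<in> F\<close> B(1) T(1) F by (intro sum_pair_diff_diff_sq_le) auto
    also have "\<dots> \<le> V (Suc j)" using B(2) unfolding V_def K(3) by (simp add: mult_ac)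
    finally show "\<exists>B\<in>T j. (\<Sum>i<m. (pair_diff A i - pair_diff B i)\<^sup>2) \<le> V (Suc j)"
      using B(1) by blast
  qed
  also have "\<dots> \<le> 2 ^ m * (\<Sum>j\<le>m. \<delta> / 4 * (1/2) ^ j)"
    using fail by (simp add: sum_mono)
  also have "\<dots> \<le> 2 ^ m * (\<delta> / 4 * 2)"
    unfolding sum_distrib_left [symmetric]
    using assms(7) sum_half_powers_le by (intro mult_left_mono) auto
  finally show ?thesis by simp
qed

section \<open>Symmetrization\<close>

lemma indep_vars_PiM_coordinates:
  assumes "J \<noteq> {}" "prob_space P"
  shows "prob_space.indep_vars (PiM J (\<lambda>_. P)) (\<lambda>_. P) (\<lambda>k y. y k) J"
proof -
  interpret N: prob_space "PiM J (\<lambda>_. P)" using assms by (intro prob_space_PiM)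
  have "distr (PiM J (\<lambda>_. P)) (PiM J (\<lambda>_. P)) (\<lambda>x. \<lambda>i\<in>J. x i) = distr (PiM J (\<lambda>_. P)) (PiM J (\<lambda>_. P)) (\<lambda>x. x)"
    by (intro distr_cong) (auto simp: space_PiM PiE_def extensional_restrict)
  also have "\<dots> = PiM J (\<lambda>_. P)" by (rule distr_id)
  also have "\<dots> = PiM J (\<lambda>i. distr (PiM J (\<lambda>_. P)) P (\<lambda>y. y i))"
    using assms(2) by (intro PiM_cong refl distr_PiM_component[where M = "\<lambda>_. P", symmetric])
  finally show ?thesis
    using assms(1) by (subst N.indep_vars_iff_distr_eq_PiM') auto
qed

lemma prob_frequency_low_le:
  assumes "prob_space P" "finite J" "J \<noteq> {}" "G \<in> sets P" "t \<ge> 0"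
  shows "measure (PiM J (\<lambda>_. P)) {y\<in>space (PiM J (\<lambda>_. P)).
      (\<Sum>k\<in>J. indicator G (y k)) \<le> card J * measure P G - t} \<le> exp (- 2 * t\<^sup>2 / card J)"
proof -
  interpret P: prob_space P by fact
  interpret N: prob_space "PiM J (\<lambda>_. P)" using assms by (intro prob_space_PiM)
  have [measurable]: "G \<in> sets P" by fact
  have indep: "N.indep_vars (\<lambda>_. borel) (\<lambda>k y. indicator G (y k) :: real) J"
    by (rule N.indep_vars_compose2[OF indep_vars_PiM_coordinates[OF assms(3,1)]]) simp
  have E: "N.expectation (\<lambda>y. indicator G (y k)) = measure P G" if "k \<in> J" for k
  proof -
    have "N.expectation (\<lambda>y. indicator G (y k)) = (\<integral>x. (indicator G x :: real) \<partial>distr (PiM J (\<lambda>_. P)) P (\<lambda>y. y k))"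
      using that by (intro integral_distr[where g = "\<lambda>y. y k" and f = "indicator G", symmetric]) auto
    also have "\<dots> = measure P G"
      using distr_PiM_component[where M = "\<lambda>_. P", OF _ that] assms(1) by simp
    finally show ?thesis .
  qed
  interpret Hoeffding_ineq "PiM J (\<lambda>_. P)" J "\<lambda>k y. indicator G (y k)" "\<lambda>_. 0" "\<lambda>_. 1" "card J * measure P G"
    by unfold_locales (use assms indep E in \<open>auto simp: indicator_def\<close>)
  show ?thesis
    using Hoeffding_ineq_le[OF assms(5)] assms(2,3) by (simp add: card_gt_0_iff)
qed

text \<open>If some \<open>h\<close> is bad on the sample, then with probability at least 1/2 its
  ghost frequency exceeds \<open>measure P (G h) - \<epsilon> / 5\<close>, so the two frequencies
  differ by more than \<open>4/5 * \<epsilon>\<close>. Swapping the bags within any set of pairs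
  preserves the joint law, and averaging over all swaps leaves a count of sign patterns for each
  fixed \<open>\<omega>\<close>.\<close>

lemma symmetrization:
  fixes P :: "'b measure" and G :: "'h \<Rightarrow> 'b set" and \<epsilon> \<beta> :: real and m :: nat
  defines "K \<equiv> {..<m} \<times> (UNIV :: bool set)"
  assumes "prob_space P" "finite H" "\<And>h. h \<in> H \<Longrightarrow> G h \<in> sets P" "1 \<le> m" "0 < \<epsilon>" "25 \<le> m * \<epsilon>\<^sup>2"
    and signs: "\<And>\<omega>. card {S\<in>Pow {..<m}. \<exists>h\<in>H. signed_sum {..<m} S (pair_diff {k\<in>K. \<omega> k \<in> G h}) > 4/5 * m * \<epsilon>}
      \<le> 2 ^ m * \<beta>"
  shows "measure (PiM {..<m} (\<lambda>_. P)) {\<omega>\<in>space (PiM {..<m} (\<lambda>_. P)).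
      \<exists>h\<in>H. measure P (G h) > card {i\<in>{..<m}. \<omega> i \<in> G h} / m + \<epsilon>} \<le> 2 * \<beta>"
proof -
  interpret P: prob_space P by fact
  define N where "N = PiM K (\<lambda>_. P)"
  define Q where "Q = PiM {..<m} (\<lambda>_. P)"
  interpret N: prob_space N unfolding N_def by (intro prob_space_PiM assms)
  interpret Q: prob_space Q unfolding Q_def by (intro prob_space_PiM assms)
  have finK: "finite K" unfolding K_def by simp
  note G [measurable] = assms(4)
  define dev where "dev h \<omega> i = indicator (G h) (\<omega> (i, True)) - (indicator (G h) (\<omega> (i, False)) :: real)"
    for h and \<omega> :: "nat \<times> bool \<Rightarrow> 'b" and i
  define E where "E S = {\<omega>\<in>space N. \<exists>h\<in>H. signed_sum {..<m} S (dev h \<omega>) > 4/5 * m * \<epsilon>}" for S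
  have signs': "card {S\<in>Pow {..<m}. \<exists>h\<in>H. signed_sum {..<m} S (dev h \<omega>) > 4/5 * m * \<epsilon>} \<le> 2 ^ m * \<beta>" for \<omega>
  proof -
    have "signed_sum {..<m} S (pair_diff {k\<in>K. \<omega> k \<in> G h}) = signed_sum {..<m} S (dev h \<omega>)" for S h
      unfolding signed_sum_def
      by (intro sum.cong) (auto simp: pair_diff_def dev_def K_def indicator_def)
    with signs[of \<omega>] show ?thesis by simp
  qed
  have dev_measurable [measurable]: "(\<lambda>\<omega>. dev h \<omega> i) \<in> borel_measurable N" if "h \<in> H" "i < m" for h i
  proof -
    have "(\<lambda>\<omega>. \<omega> (i, b)) \<in> measurable N P" for b
      unfolding N_def using that by (intro measurable_component_singleton) (auto simp: K_def)
    then show ?thesis unfolding dev_def using G[OF that(1)] by measurable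
  qed
  have ssum_measurable: "(\<lambda>\<omega>. signed_sum {..<m} S (dev h \<omega>)) \<in> borel_measurable N" if "h \<in> H" for S h
    unfolding signed_sum_def
  proof (intro borel_measurable_sum)
    fix i assume "i \<in> {..<m}"
    then show "(\<lambda>\<omega>. if i \<in> S then - dev h \<omega> i else dev h \<omega> i) \<in> borel_measurable N"
      using dev_measurable[OF that, of i] by (cases "i \<in> S") auto
  qed
  have E_sets: "E S \<in> sets N" for S
  proof -
    have "E S = (\<Union>h\<in>H. {\<omega>\<in>space N. signed_sum {..<m} S (dev h \<omega>) > 4/5 * m * \<epsilon>})"
      unfolding E_def by auto
    also have "\<dots> \<in> sets N"
      using ssum_measurable by (intro sets.finite_UN assms borel_measurable_less) auto
    finally show ?thesis .
  qed

  \<comment> \<open>The map \<open>f\<close> exchanges the two bags of each pair in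
    \<open>S\<close>. It permutes the index set, hence preserves the product measure, and it negates
    exactly the differences with index in \<open>S\<close>.\<close>
  have swap: "measure N (E S) = measure N (E {})" for S
  proof -
    define f where "f = (\<lambda>(i, b). (i, b \<noteq> (i \<in> S)))"
    define \<phi> where "\<phi> \<omega> = (\<lambda>k\<in>K. \<omega> (f k))" for \<omega> :: "nat \<times> bool \<Rightarrow> 'b"
    have f: "inj_on f K" "f \<in> K \<rightarrow> K" unfolding f_def K_def by (auto simp: inj_on_def)
    have distr: "distr N N \<phi> = N"
      using distr_PiM_reindex[OF _ f, of "\<lambda>_. P"] assms(2) unfolding N_def \<phi>_def by simp
    have meas: "\<phi> \<in> measurable N N"
      unfolding \<phi>_def N_def
      by (intro measurable_restrict measurable_component_singleton) (use f(2) in auto)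
    have "dev h (\<phi> \<omega>) i = (if i \<in> S then - dev h \<omega> i else dev h \<omega> i)" if "i < m" for h \<omega> i
      using that unfolding dev_def \<phi>_def f_def K_def by auto
    then have "signed_sum {..<m} {} (dev h (\<phi> \<omega>)) = signed_sum {..<m} S (dev h \<omega>)" for h \<omega>
      unfolding signed_sum_def by (intro sum.cong) auto
    then have "\<phi> -` E {} \<inter> space N = E S"
      using measurable_space[OF meas] unfolding E_def by auto
    then show ?thesis
      using measure_distr[OF meas E_sets[of "{}"]] unfolding distr by simp
  qed
  have E_le: "measure N (E {}) \<le> \<beta>"
  proof -
    \<comment> \<open>All \<open>2 ^ m\<close> events \<open>E S\<close> are equally likely, so
      exchanging sum and integral bounds their common probability by the pointwise sign
      count.\<close>
    have "2 ^ m * measure N (E {}) = (\<Sum>S\<in>Pow {..<m}. measure N (E {}))"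
      by (simp add: card_Pow)
    also have "\<dots> = (\<Sum>S\<in>Pow {..<m}. measure N (E S))"
      by (intro sum.cong refl swap [symmetric])
    also have "\<dots> = (\<Sum>S\<in>Pow {..<m}. \<integral>\<omega>. indicator (E S) \<omega> \<partial>N)"
      using E_sets by simp
    also have "\<dots> = (\<integral>\<omega>. (\<Sum>S\<in>Pow {..<m}. indicator (E S) \<omega>) \<partial>N)"
      using E_sets by (intro Bochner_Integration.integral_sum [symmetric])
        (auto simp: N.emeasure_eq_measure)
    also have "\<dots> \<le> (\<integral>\<omega>. 2 ^ m * \<beta> \<partial>N)"
    proof (rule integral_mono)
      fix \<omega> assume "\<omega> \<in> space N"
      then have "(\<Sum>S\<in>Pow {..<m}. indicator (E S) \<omega> :: real) =
          (\<Sum>S\<in>Pow {..<m}. if \<exists>h\<in>H. signed_sum {..<m} S (dev h \<omega>) > 4/5 * m * \<epsilon> then 1 else 0)"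
        by (intro sum.cong) (auto simp: E_def)
      also have "\<dots> = card {S\<in>Pow {..<m}. \<exists>h\<in>H. signed_sum {..<m} S (dev h \<omega>) > 4/5 * m * \<epsilon>}"
        by (simp add: sum.If_cases Int_def)
      finally show "(\<Sum>S\<in>Pow {..<m}. indicator (E S) \<omega>) \<le> 2 ^ m * \<beta>" using signs'[of \<omega>] by simp
    qed (use E_sets in \<open>auto intro!: Bochner_Integration.integrable_sum simp: N.emeasure_eq_measure\<close>)
    also have "\<dots> = 2 ^ m * \<beta>" by (simp add: N.prob_space)
    finally show ?thesis by simp
  qed

  define I0 where "I0 = {..<m} \<times> {False}"
  define I1 where "I1 = {..<m} \<times> {True}"
  define Q0 where "Q0 = PiM I0 (\<lambda>_. P)"
  define Q1 where "Q1 = PiM I1 (\<lambda>_. P)"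
  interpret Q0: prob_space Q0 unfolding Q0_def by (intro prob_space_PiM assms)
  interpret Q1: prob_space Q1 unfolding Q1_def by (intro prob_space_PiM assms)
  have I: "I0 \<inter> I1 = {}" "finite I0" "finite I1" "I0 \<union> I1 = K" "I1 \<noteq> {}"
    using assms(5) unfolding I0_def I1_def K_def by (auto simp: lessThan_empty_iff)
  define bad where "bad = {\<omega>\<in>space Q. \<exists>h\<in>H. measure P (G h) > card {i\<in>{..<m}. \<omega> i \<in> G h} / m + \<epsilon>}"
  define \<psi> where "\<psi> \<omega> = (\<lambda>i\<in>{..<m}. \<omega> (i, False))" for \<omega> :: "nat \<times> bool \<Rightarrow> 'b"
  have \<psi>: "distr Q0 Q \<psi> = Q"
    using distr_PiM_reindex[of I0 "\<lambda>_. P" "\<lambda>i. (i, False)" "{..<m}"] assms(2)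
    unfolding Q0_def Q_def \<psi>_def by (simp add: I0_def inj_on_def)
  have \<psi>_meas: "\<psi> \<in> measurable Q0 Q"
    unfolding \<psi>_def Q_def Q0_def
    by (intro measurable_restrict measurable_component_singleton) (auto simp: I0_def)
  have bad_sets: "bad \<in> sets Q"
  proof -
    have "{\<omega>\<in>space Q. measure P (G h) > card {i\<in>{..<m}. \<omega> i \<in> G h} / m + \<epsilon>} \<in> sets Q" if "h \<in> H" for h
    proof -
      have "(\<lambda>\<omega>. (\<Sum>i<m. indicator (G h) (\<omega> i)) :: real) \<in> borel_measurable Q"
        using G[OF that] unfolding Q_def by measurable
      also have "(\<lambda>\<omega>. (\<Sum>i<m. indicator (G h) (\<omega> i)) :: real) = (\<lambda>\<omega>. real (card {i\<in>{..<m}. \<omega> i \<in> G h}))"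
        by (auto simp: indicator_def sum.If_cases Int_def)
      finally have [measurable]: "(\<lambda>\<omega>. real (card {i\<in>{..<m}. \<omega> i \<in> G h})) \<in> borel_measurable Q" .
      show ?thesis by measurable
    qed
    then have "(\<Union>h\<in>H. {\<omega>\<in>space Q. measure P (G h) > card {i\<in>{..<m}. \<omega> i \<in> G h} / m + \<epsilon>}) \<in> sets Q"
      using assms(3) by (intro sets.finite_UN)
    also have "(\<Union>h\<in>H. {\<omega>\<in>space Q. measure P (G h) > card {i\<in>{..<m}. \<omega> i \<in> G h} / m + \<epsilon>}) = bad"
      unfolding bad_def by auto
    finally show ?thesis .
  qed
  define bad0 where "bad0 = \<psi> -` bad \<inter> space Q0"
  have bad0_sets [measurable]: "bad0 \<in> sets Q0"
    unfolding bad0_def using \<psi>_meas bad_sets by (rule measurable_sets)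
  have ghost: "emeasure Q1 {y\<in>space Q1. (\<Sum>i<m. indicator (G h) (y (i, True))) > m * measure P (G h) - m * \<epsilon> / 5} \<ge> ennreal (1/2)"
    and ghost_sets: "{y\<in>space Q1. (\<Sum>i<m. indicator (G h) (y (i, True))) > m * measure P (G h) - m * \<epsilon> / 5} \<in> sets Q1"
    if "h \<in> H" for h
  proof -
    define X where "X y = (\<Sum>i<m. indicator (G h) (y (i, True)) :: real)" for y :: "nat \<times> bool \<Rightarrow> 'b"
    have X_sum: "X y = (\<Sum>k\<in>I1. indicator (G h) (y k))" for y
      unfolding X_def I1_def
      by (rule sum.reindex_bij_witness[where i = fst and j = "\<lambda>i. (i, True)"]) auto
    have X_meas [measurable]: "X \<in> borel_measurable Q1"
      unfolding X_sum Q1_def using G[OF that] by measurable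
    have cI1: "card I1 = m" unfolding I1_def by (simp add: card_cartesian_product)
    have "Q1.prob {y\<in>space Q1. X y \<le> m * measure P (G h) - m * \<epsilon> / 5} \<le> exp (- 2 * (m * \<epsilon> / 5)\<^sup>2 / m)"
      using prob_frequency_low_le[OF assms(2) I(3,5) G[OF that], of "m * \<epsilon> / 5"] assms(6)
      unfolding X_sum Q1_def cI1 by simp
    also have "- 2 * (m * \<epsilon> / 5)\<^sup>2 / m = - (2 / 25 * (m * \<epsilon>\<^sup>2))"
      using assms(5) by (simp add: power2_eq_square)
    also have "exp \<dots> \<le> exp (- 1)" using assms(7) by simp
    also have "exp (- 1) \<le> (1/2::real)"
      using exp_ge_add_one_self[of 1] by (simp add: exp_minus field_simps)
    finally have "Q1.prob {y\<in>space Q1. X y \<le> m * measure P (G h) - m * \<epsilon> / 5} \<le> 1/2" by simp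
    moreover have "Q1.prob {y\<in>space Q1. \<not> X y \<le> m * measure P (G h) - m * \<epsilon> / 5}
        = 1 - Q1.prob {y\<in>space Q1. X y \<le> m * measure P (G h) - m * \<epsilon> / 5}"
      by (rule Q1.prob_neg) measurable
    ultimately have "1/2 \<le> Q1.prob {y\<in>space Q1. X y > m * measure P (G h) - m * \<epsilon> / 5}"
      by (simp add: not_le)
    then have "ennreal (1/2) \<le> emeasure Q1 {y\<in>space Q1. X y > m * measure P (G h) - m * \<epsilon> / 5}"
      unfolding Q1.emeasure_eq_measure by (rule ennreal_leI)
    then show "emeasure Q1 {y\<in>space Q1. (\<Sum>i<m. indicator (G h) (y (i, True))) > m * measure P (G h) - m * \<epsilon> / 5} \<ge> ennreal (1/2)"
      unfolding X_def .
    have "{y\<in>space Q1. X y > m * measure P (G h) - m * \<epsilon> / 5} \<in> sets Q1" by measurable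
    then show "{y\<in>space Q1. (\<Sum>i<m. indicator (G h) (y (i, True))) > m * measure P (G h) - m * \<epsilon> / 5} \<in> sets Q1"
      unfolding X_def .
  qed

  interpret product_sigma_finite "\<lambda>_::nat \<times> bool. P" by standard
  have "ennreal (1/2) * emeasure Q0 bad0 = (\<integral>\<^sup>+x. ennreal (1/2) * indicator bad0 x \<partial>Q0)"
    by (rule nn_integral_cmult_indicator [symmetric]) (rule bad0_sets)
  also have "\<dots> \<le> (\<integral>\<^sup>+x. \<integral>\<^sup>+y. indicator (E {}) (merge I0 I1 (x, y)) \<partial>Q1 \<partial>Q0)"
  proof (rule nn_integral_mono)
    fix x assume x: "x \<in> space Q0"
    show "ennreal (1/2) * indicator bad0 x \<le> (\<integral>\<^sup>+y. indicator (E {}) (merge I0 I1 (x, y)) \<partial>Q1)"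
    proof (cases "x \<in> bad0")
      case True
      \<comment> \<open>The choice of \<open>h\<close> depends on the sample \<open>x\<close> alone,
        so the ghost estimate for this fixed \<open>h\<close> applies in the inner integral over
        \<open>y\<close>.\<close>
      then obtain h where h: "h \<in> H" "measure P (G h) > card {i\<in>{..<m}. x (i, False) \<in> G h} / m + \<epsilon>"
        unfolding bad0_def bad_def \<psi>_def by (auto simp: conj_commute cong: conj_cong)
      have "real (card {i\<in>{..<m}. x (i, False) \<in> G h}) = (\<Sum>i<m. indicator (G h) (x (i, False)))"
        by (auto simp: indicator_def sum.If_cases Int_def)
      with h(2) assms(5) have low: "(\<Sum>i<m. indicator (G h) (x (i, False))) < m * measure P (G h) - m * \<epsilon>"
        by (simp add: field_simps)
      define Y where "Y = {y\<in>space Q1. (\<Sum>i<m. indicator (G h) (y (i, True))) > m * measure P (G h) - m * \<epsilon> / 5}"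
      have "ennreal (1/2) * indicator bad0 x \<le> emeasure Q1 Y" using ghost[OF h(1)] True unfolding Y_def by (simp only: indicator_simps mult_1_right)
      also have "\<dots> = (\<integral>\<^sup>+y. indicator Y y \<partial>Q1)" using ghost_sets[OF h(1)] unfolding Y_def by simp
      also have "\<dots> \<le> (\<integral>\<^sup>+y. indicator (E {}) (merge I0 I1 (x, y)) \<partial>Q1)"
      proof (rule nn_integral_mono)
        fix y assume y: "y \<in> space Q1"
        have "merge I0 I1 (x, y) \<in> E {}" if "y \<in> Y"
        proof -
          have "merge I0 I1 (x, y) \<in> space N"
            using x y I(1,4) unfolding N_def Q0_def Q1_def space_PiM I(4) [symmetric] by auto
          moreover have "signed_sum {..<m} {} (dev h (merge I0 I1 (x, y)))
              = (\<Sum>i<m. indicator (G h) (y (i, True))) - (\<Sum>i<m. indicator (G h) (x (i, False)))"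
            unfolding signed_sum_def dev_def sum_subtractf [symmetric]
            by (intro sum.cong) (auto simp: merge_def I0_def I1_def)
          moreover have "\<dots> > 4/5 * m * \<epsilon>"
            using low that unfolding Y_def by simp
          ultimately show ?thesis using h(1) unfolding E_def
            by (intro CollectI conjI bexI[of _ h]) (simp_all only:)
        qed
        then show "indicator Y y \<le> (indicator (E {}) (merge I0 I1 (x, y)) :: ennreal)"
          by (auto simp: indicator_def)
      qed
      finally show ?thesis .
    qed simp
  qed
  also have "\<dots> = (\<integral>\<^sup>+\<omega>. indicator (E {}) \<omega> \<partial>N)"
    using product_nn_integral_fold[OF I(1-3), of "indicator (E {})"] E_sets[of "{}"]
    unfolding I(4) N_def Q0_def Q1_def by simp
  also have "\<dots> = emeasure N (E {})" using E_sets by simp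
  finally have "ennreal (1/2 * measure Q0 bad0) \<le> ennreal (measure N (E {}))"
    unfolding N.emeasure_eq_measure Q0.emeasure_eq_measure
    by (subst ennreal_mult) simp_all
  then have "1/2 * measure Q0 bad0 \<le> measure N (E {})" by simp
  moreover have "measure Q bad = measure Q0 bad0"
    using measure_distr[OF \<psi>_meas bad_sets] unfolding \<psi> bad0_def .
  ultimately have "measure Q bad \<le> 2 * \<beta>" using E_le by simp
  then show ?thesis unfolding bad_def Q_def .
qed

section \<open>Bags\<close>

lemma is_ltf_measurable:
  assumes "sets D = sets (PiM {..<d} (\<lambda>_. borel))" "is_ltf d h"
  shows "h \<in> borel_measurable D"
proof -
  obtain r c where h: "h = ltf d r c" using assms(2) unfolding is_ltf_def by blast
  have "ltf d r c \<in> borel_measurable (PiM {..<d} (\<lambda>_. borel))"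
    unfolding ltf_def by measurable
  then show ?thesis unfolding h using measurable_cong_sets[OF assms(1) refl] by blast
qed

text \<open>Positive mass of both label classes makes the two conditional distributions, and hence
  the bag distribution, probability measures.\<close>

locale bag_problem =
  fixes d q k :: nat and D :: "(nat \<Rightarrow> real) measure" and f :: "(nat \<Rightarrow> real) \<Rightarrow> real"
  assumes prob_D: "prob_space D" and sets_D: "sets D = sets (PiM {..<d} (\<lambda>_. borel))"
    and pos: "emeasure D {x \<in> space D. f x = 1} > 0" "emeasure D {x \<in> space D. f x = 0} > 0"
begin

abbreviation P where "P \<equiv> bag_oracle D f q k"

definition wrong :: "((nat \<Rightarrow> real) \<Rightarrow> real) \<Rightarrow> (nat \<Rightarrow> nat \<Rightarrow> real) set" where
  "wrong h = {B \<in> space P. bag_avg h q B \<noteq> real k / real q}"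

lemma bag_err_oracle_eq: "bag_err_oracle h f D q k = measure P (wrong h)"
  unfolding bag_err_oracle_def wrong_def ..

lemma prob_space_bag_oracle: "prob_space P"
proof -
  interpret prob_space D by (rule prob_D)
  show ?thesis
    unfolding bag_oracle_def using pos
    by (intro prob_space_PiM) (auto intro!: prob_space_uniform_measure)
qed

lemma bag_component_measurable: "i < q \<Longrightarrow> (\<lambda>B. B i) \<in> measurable P D"
proof -
  assume "i < q"
  have "sets P = sets (PiM {..<q} (\<lambda>_. D))"
    unfolding bag_oracle_def by (intro sets_PiM_cong) auto
  then have "measurable P D = measurable (PiM {..<q} (\<lambda>_. D)) D"
    by (rule measurable_cong_sets) simp
  with \<open>i < q\<close> show "(\<lambda>B. B i) \<in> measurable P D" by simp
qed

lemma bag_avg_measurable: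
  assumes "is_ltf d h"
  shows "bag_avg h q \<in> borel_measurable P"
proof -
  have "(\<lambda>B. h (B i)) \<in> borel_measurable P" if "i < q" for i
    using measurable_compose[OF bag_component_measurable[OF that] is_ltf_measurable[OF sets_D assms]] .
  then show ?thesis unfolding bag_avg_def by measurable
qed

lemma wrong_sets: "is_ltf d h \<Longrightarrow> wrong h \<in> sets P"
  unfolding wrong_def using bag_avg_measurable[of h] by measurable

lemma bag_err_sample_eq:
  assumes "M \<in> space (bag_sample_space D f q k m)"
  shows "bag_err_sample h q k m M = card {j\<in>{..<m}. M j \<in> wrong h} / m"
proof -
  have "M j \<in> space P" if "j < m" for j
    using assms that unfolding bag_sample_space_def space_PiM by auto
  then have "{j\<in>{..<m}. bag_avg h q (M j) \<noteq> real k / real q} = {j\<in>{..<m}. M j \<in> wrong h}"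
    unfolding wrong_def by auto
  then show ?thesis unfolding bag_err_sample_def by simp
qed

lemma bag_err_sample_measurable:
  assumes "is_ltf d h"
  shows "bag_err_sample h q k m \<in> borel_measurable (bag_sample_space D f q k m)"
proof -
  have [measurable]: "wrong h \<in> sets P" using assms by (rule wrong_sets)
  have "(\<lambda>M. (\<Sum>j<m. indicator (wrong h) (M j)) / real m) \<in> borel_measurable (bag_sample_space D f q k m)"
    unfolding bag_sample_space_def by measurable
  moreover have "(\<Sum>j<m. indicator (wrong h) (M j)) / real m = bag_err_sample h q k m M"
    if "M \<in> space (bag_sample_space D f q k m)" for M
    unfolding bag_err_sample_eq[OF that] by (simp add: indicator_def sum.If_cases Int_def)
  ultimately show ?thesis by (subst (asm) measurable_cong) auto
qed

text \<open>Symmetrization for the events \<open>wrong h\<close>, fed by the chaining estimate for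
  their traces on \<open>2 * m\<close> bags. The bound is independent of the size of
  \<open>H\<close>, which permits a passage to countable families.\<close>

lemma finite_family_bound:
  fixes \<delta> \<epsilon> :: real
  assumes "finite H" "\<And>h. h \<in> H \<Longrightarrow> is_ltf d h" "1 \<le> d" "2 \<le> q" "0 < \<delta>" "\<delta> < 1" "0 < \<epsilon>"
    and m: "real m \<ge> 1000 * real d * (ln (real q) + ln (1 / \<delta>)) / \<epsilon>\<^sup>2"
  shows "measure (bag_sample_space D f q k m) {M \<in> space (bag_sample_space D f q k m).
      \<exists>h\<in>H. bag_err_oracle h f D q k > bag_err_sample h q k m M + \<epsilon>} \<le> \<delta>"
proof -
  define L where "L = ln (real q) + ln (1 / \<delta>)"
  have "ln 2 \<le> ln (real q)" using assms(4) by simp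
  moreover have "ln (1 / \<delta>) > 0" using assms(5,6) by simp
  moreover have "ln 2 \<ge> (1/2 :: real)" using ln2_ge_two_thirds by simp
  ultimately have L: "L \<ge> 1/2" unfolding L_def by linarith
  have mL: "m * \<epsilon>\<^sup>2 \<ge> 1000 * d * L"
    using m assms(7) unfolding L_def by (simp add: field_simps)
  have dL: "d * L \<ge> 1 * (1/2)" using L assms(3) by (intro mult_mono) auto
  then have "m * \<epsilon>\<^sup>2 \<ge> 25" using mL by simp
  then have "1 \<le> m" by (cases m) auto
  have growth: "real (card ((\<lambda>A. A \<inter> S) ` (\<lambda>h. {i\<in>{..<m} \<times> UNIV. \<omega> i \<in> wrong h}) ` H))
      \<le> (1 / x) ^ Suc d * exp (x * (q * card S))"
    if S: "S \<subseteq> {..<m} \<times> (UNIV :: bool set)" "0 < x" "x \<le> 1" for \<omega> S and x :: real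
  proof -
    \<comment> \<open>\<open>\<omega>\<close> is arbitrary, while \<open>wrong h\<close> contains
      only bags from \<open>space P\<close>. Indices of other values belong to no trace and are
      dropped before the halfspace bound is applied.\<close>
    define S' where "S' = {s\<in>S. \<omega> s \<in> space P}"
    have fin: "finite S" using S(1) by (rule finite_subset) simp
    have "{i\<in>{..<m} \<times> UNIV. \<omega> i \<in> wrong h} \<inter> S = {s\<in>S'. bag_avg h q (\<omega> s) \<noteq> real k / real q}" for h
      using S(1) unfolding S'_def wrong_def by auto
    then have "real (card ((\<lambda>A. A \<inter> S) ` (\<lambda>h. {i\<in>{..<m} \<times> UNIV. \<omega> i \<in> wrong h}) ` H))
        = real (card ((\<lambda>h. {s\<in>S'. bag_avg h q (\<omega> s) \<noteq> real k / real q}) ` H))"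
      unfolding image_image by simp
    also have "\<dots> \<le> (1 / x) ^ Suc d * exp (x * (q * card S'))"
      using fin assms(2) S by (intro card_bag_traces_le) (auto simp: S'_def)
    also have "\<dots> \<le> (1 / x) ^ Suc d * exp (x * (q * card S))"
    proof -
      have "card S' \<le> card S" using fin unfolding S'_def by (intro card_mono) auto
      then have "real (q * card S') \<le> real (q * card S)" by (intro of_nat_mono mult_le_mono2)
      then have "x * real (q * card S') \<le> x * real (q * card S)" using S(2) by (intro mult_left_mono) auto
      then show ?thesis using S(2) by (intro mult_left_mono) auto
    qed
    finally show ?thesis .
  qed
  \<comment> \<open>\<open>d + 1 \<le> 2 * d\<close> turns the constant 500 for \<open>d + 1\<close>
    into 1000 for \<open>d\<close>.\<close>
  have "500 * real (Suc d) * L \<le> 1000 * d * L"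
    using L assms(3) by (intro mult_right_mono) auto
  with mL have "500 * real (Suc d) * (ln (real q) + ln (1 / \<delta>)) \<le> m * \<epsilon>\<^sup>2"
    unfolding L_def by linarith
  then have "card {S\<in>Pow {..<m}. \<exists>A\<in>(\<lambda>h. {i\<in>{..<m} \<times> UNIV. \<omega> i \<in> wrong h}) ` H.
      signed_sum {..<m} S (pair_diff A) > 4/5 * m * \<epsilon>} \<le> 2 ^ m * (\<delta> / 2)" for \<omega>
    using assms(4-7) \<open>1 \<le> m\<close> growth
    by (intro card_signed_pair_diff_gt_le[where D = "Suc d" and q = q]) auto
  then have signs: "card {S\<in>Pow {..<m}. \<exists>h\<in>H. signed_sum {..<m} S
      (pair_diff {i\<in>{..<m} \<times> UNIV. \<omega> i \<in> wrong h}) > 4/5 * m * \<epsilon>} \<le> 2 ^ m * (\<delta> / 2)" for \<omega>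
    by simp
  have "measure (PiM {..<m} (\<lambda>_. P)) {\<omega>\<in>space (PiM {..<m} (\<lambda>_. P)).
      \<exists>h\<in>H. measure P (wrong h) > card {i\<in>{..<m}. \<omega> i \<in> wrong h} / m + \<epsilon>} \<le> 2 * (\<delta> / 2)"
    using assms(2) by (intro symmetrization[OF prob_space_bag_oracle assms(1) _ \<open>1 \<le> m\<close> assms(7)
      \<open>25 \<le> m * \<epsilon>\<^sup>2\<close> signs] wrong_sets)
  also have "{\<omega>\<in>space (PiM {..<m} (\<lambda>_. P)).
      \<exists>h\<in>H. measure P (wrong h) > card {i\<in>{..<m}. \<omega> i \<in> wrong h} / m + \<epsilon>} =
    {M \<in> space (bag_sample_space D f q k m).
      \<exists>h\<in>H. bag_err_oracle h f D q k > bag_err_sample h q k m M + \<epsilon>}"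
    using bag_err_sample_eq[of _ m] unfolding bag_err_oracle_eq bag_sample_space_def by auto
  finally show ?thesis unfolding bag_sample_space_def by simp
qed

text \<open>Dominated convergence: a bag has finitely many points, so \<open>g n\<close> eventually
  agrees with \<open>h\<close> at all of them and the failure indicators coincide.\<close>

lemma bag_err_oracle_tendsto:
  assumes "is_ltf d h" "\<And>n. is_ltf d (g n)" "\<And>x. eventually (\<lambda>n. g n x = h x) sequentially"
  shows "(\<lambda>n. bag_err_oracle (g n) f D q k) \<longlonglongrightarrow> bag_err_oracle h f D q k"
proof -
  interpret prob_space P by (rule prob_space_bag_oracle)
  have "(\<lambda>n. \<integral>B. indicator (wrong (g n)) B \<partial>P) \<longlonglongrightarrow> (\<integral>B. (indicator (wrong h) B :: real) \<partial>P)"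
  proof (rule integral_dominated_convergence[where w = "\<lambda>_. 1"])
    show "AE B in P. (\<lambda>n. indicator (wrong (g n)) B :: real) \<longlonglongrightarrow> indicator (wrong h) B"
    proof (rule AE_I2, rule tendsto_eventually)
      fix B
      have "eventually (\<lambda>n. \<forall>i\<in>{..<q}. g n (B i) = h (B i)) sequentially"
        using assms(3) by (intro eventually_ball_finite) auto
      then show "eventually (\<lambda>n. (indicator (wrong (g n)) B :: real) = indicator (wrong h) B) sequentially"
        by eventually_elim (simp add: wrong_def bag_avg_def indicator_def)
    qed
  qed (use assms wrong_sets in \<open>auto simp: indicator_def\<close>)
  then show ?thesis
    using assms(1,2) wrong_sets by (simp add: bag_err_oracle_eq)
qed

end

section \<open>Passage from rational to arbitrary halfspaces\<close>

lemma bag_err_sample_eventually_eq: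
  assumes "\<And>x. eventually (\<lambda>n. g n x = h x) sequentially"
  shows "eventually (\<lambda>n. bag_err_sample (g n) q k m M = bag_err_sample h q k m M) sequentially"
proof -
  have "eventually (\<lambda>n. \<forall>j\<in>{..<m}. \<forall>i\<in>{..<q}. g n (M j i) = h (M j i)) sequentially"
    using assms by (intro eventually_ball_finite ballI) auto
  then show ?thesis
  proof eventually_elim
    case (elim n)
    then have "{j\<in>{..<m}. bag_avg (g n) q (M j) \<noteq> real k / real q}
        = {j\<in>{..<m}. bag_avg h q (M j) \<noteq> real k / real q}"
      by (auto simp: bag_avg_def)
    then show ?case unfolding bag_err_sample_def by simp
  qed
qed

text \<open>An enumeration of halfspaces with weights read from a list of rationals. If the list is
  shorter than \<open>d\<close>, the missing weights are unspecified but fixed, so every index still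
  denotes a halfspace.\<close>

definition rat_ltf :: "nat \<Rightarrow> nat \<Rightarrow> (nat \<Rightarrow> real) \<Rightarrow> real" where
  "rat_ltf d n = (case from_nat n of (rs :: rat list, c) \<Rightarrow> ltf d (\<lambda>i. of_rat (rs ! i)) (of_rat c))"

lemma is_ltf_rat_ltf: "is_ltf d (rat_ltf d n)"
  unfolding rat_ltf_def is_ltf_def by (auto split: prod.split)

lemma ltf_eq_rat_ltf: "\<exists>n. ltf d (\<lambda>i. of_rat (r i)) (of_rat c) = rat_ltf d n"
proof
  show "ltf d (\<lambda>i. of_rat (r i)) (of_rat c) = rat_ltf d (to_nat (map r [0..<d], c))"
    unfolding rat_ltf_def ltf_def by (auto intro!: ext)
qed

text \<open>Shifting the threshold down by about \<open>1/n\<close>, which dominates the \<open>1/n\<^sup>2\<close>-error made in the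
  weights, keeps the points on the hyperplane itself on the negative side.\<close>

lemma rat_ltf_approx:
  assumes "is_ltf d h"
  shows "\<exists>j. \<forall>x. eventually (\<lambda>n. rat_ltf d (j n) x = h x) sequentially"
proof -
  obtain r c where h: "h = ltf d r c" using assms unfolding is_ltf_def by blast
  have "\<exists>\<rho>. \<forall>i. \<bar>of_rat (\<rho> i) - r i\<bar> < 1 / (real n + 1)\<^sup>2" for n :: nat
  proof -
    have "\<exists>s. \<bar>of_rat s - r i\<bar> < 1 / (real n + 1)\<^sup>2" for i
    proof -
      have "r i < r i + 1 / (real n + 1)\<^sup>2" by simp
      then obtain s where "r i < of_rat s" "of_rat s < r i + 1 / (real n + 1)\<^sup>2"
        using of_rat_dense by blast
      then show ?thesis by (intro exI[of _ s]) linarith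
    qed
    then show ?thesis by metis
  qed
  then obtain \<rho> where \<rho>: "\<And>n i. \<bar>of_rat (\<rho> n i) - r i\<bar> < 1 / (real n + 1)\<^sup>2" by metis
  have "\<exists>t. c - 2 / (real n + 1) < of_rat t \<and> of_rat t < c - 1 / (real n + 1)" for n
    by (rule of_rat_dense) (simp add: divide_strict_right_mono)
  then obtain \<tau> where \<tau>: "\<And>n. c - 2 / (real n + 1) < of_rat (\<tau> n)" "\<And>n. of_rat (\<tau> n) < c - 1 / (real n + 1)"
    by metis
  have "\<forall>n. \<exists>j. ltf d (\<lambda>i. of_rat (\<rho> n i)) (of_rat (\<tau> n)) = rat_ltf d j"
    using ltf_eq_rat_ltf by blast
  then obtain j where j: "\<And>n. ltf d (\<lambda>i. of_rat (\<rho> n i)) (of_rat (\<tau> n)) = rat_ltf d (j n)"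
    by (auto dest: choice)
  have "eventually (\<lambda>n. rat_ltf d (j n) x = h x) sequentially" for x
  proof -
    define X where "X = (\<Sum>i<d. \<bar>x i\<bar>)"
    define s where "s = (\<Sum>i<d. r i * x i) + c"
    \<comment> \<open>\<open>X < N\<close> keeps the weight error below
      \<open>e = 1 / (n + 1)\<close>, and \<open>3 / \<bar>s\<bar> < N\<close> makes
      \<open>3 * e\<close> smaller than a positive \<open>s\<close>. For \<open>s \<le> 0\<close>,
      including \<open>s = 0\<close> where the quotient is 0, \<open>t < s\<close> settles the
      sign.\<close>
    obtain N where N: "X < real N" "3 / \<bar>s\<bar> < real N"
      using reals_Archimedean2[of "max X (3 / \<bar>s\<bar>)"] by auto
    show ?thesis
    proof (rule eventually_sequentiallyI[of N])
      fix n assume n: "N \<le> n"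
      define e where "e = 1 / (real n + 1)"
      have e: "e > 0" "e\<^sup>2 = 1 / (real n + 1)\<^sup>2" unfolding e_def by (auto simp: power_divide)
      have "X * e < 1" using N n unfolding e_def by (simp add: field_simps)
      then have "X * e * e < 1 * e" using e by (intro mult_strict_right_mono)
      then have Xe: "X * e\<^sup>2 < e" by (simp add: power2_eq_square mult_ac)
      define t where "t = (\<Sum>i<d. of_rat (\<rho> n i) * x i) + of_rat (\<tau> n)"
      have "\<bar>(\<Sum>i<d. of_rat (\<rho> n i) * x i) - (\<Sum>i<d. r i * x i)\<bar> \<le> (\<Sum>i<d. \<bar>(of_rat (\<rho> n i) - r i) * x i\<bar>)"
        unfolding sum_subtractf [symmetric] left_diff_distrib by (rule sum_abs)
      also have "\<dots> \<le> (\<Sum>i<d. e\<^sup>2 * \<bar>x i\<bar>)"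
        unfolding abs_mult e(2) using \<rho> by (intro sum_mono mult_right_mono) (auto intro: less_imp_le)
      also have "\<dots> = X * e\<^sup>2" unfolding X_def by (simp add: sum_distrib_left mult.commute)
      finally have "\<bar>(\<Sum>i<d. of_rat (\<rho> n i) * x i) - (\<Sum>i<d. r i * x i)\<bar> < e" using Xe by linarith
      moreover have "c - 2 * e < of_rat (\<tau> n)" "of_rat (\<tau> n) < c - e"
        using \<tau>[of n] unfolding e_def by auto
      ultimately have t: "t < s" "s - 3 * e < t" unfolding t_def s_def by linarith+
      have "t > 0 \<longleftrightarrow> s > 0"
      proof
        assume "s > 0"
        then have "3 < s * N" using N(2) by (simp add: field_simps)
        also have "s * N \<le> s * (real n + 1)" using n \<open>s > 0\<close> by (intro mult_left_mono) auto
        finally have "3 * e < s" unfolding e_def by (simp add: field_simps)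
        with t show "t > 0" by linarith
      qed (use t in linarith)
      then show "rat_ltf d (j n) x = h x"
        unfolding j [symmetric] h ltf_def t_def s_def by simp
    qed
  qed
  then show ?thesis by blast
qed

text \<open>The events \<open>C N\<close> for the first \<open>N + 1\<close> rational halfspaces
  decrease and each has probability at least \<open>1 - \<delta>\<close>, so their intersection does
  too. On it the inequality passes to every halfspace in the limit along rational
  approximations.\<close>

lemma (in bag_problem) uniform_bound:
  fixes \<delta> \<epsilon> :: real
  assumes "1 \<le> d" "2 \<le> q" "0 < \<delta>" "\<delta> < 1" "0 < \<epsilon>"
    and m: "real m \<ge> 1000 * real d * (ln (real q) + ln (1 / \<delta>)) / \<epsilon>\<^sup>2"
  shows "\<exists>A \<in> sets (bag_sample_space D f q k m).
    measure (bag_sample_space D f q k m) A \<ge> 1 - \<delta> \<and>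
    (\<forall>M \<in> A. \<forall>h. is_ltf d h \<longrightarrow> bag_err_oracle h f D q k \<le> bag_err_sample h q k m M + \<epsilon>)"
proof -
  let ?S = "bag_sample_space D f q k m"
  interpret S: prob_space ?S
    unfolding bag_sample_space_def by (intro prob_space_PiM prob_space_bag_oracle)
  define C where "C N = {M \<in> space ?S. \<forall>n\<le>N. bag_err_oracle (rat_ltf d n) f D q k \<le> bag_err_sample (rat_ltf d n) q k m M + \<epsilon>}"
    for N
  have C_sets: "C N \<in> sets ?S" for N
  proof -
    have "{M \<in> space ?S. bag_err_oracle (rat_ltf d n) f D q k \<le> bag_err_sample (rat_ltf d n) q k m M + \<epsilon>} \<in> sets ?S" for n
      using bag_err_sample_measurable[OF is_ltf_rat_ltf] by (intro borel_measurable_le borel_measurable_add) simp_all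
    then have "(\<Inter>n\<in>{..N}. {M \<in> space ?S. bag_err_oracle (rat_ltf d n) f D q k \<le> bag_err_sample (rat_ltf d n) q k m M + \<epsilon>}) \<in> sets ?S"
      by (intro sets.finite_INT) auto
    also have "(\<Inter>n\<in>{..N}. {M \<in> space ?S. bag_err_oracle (rat_ltf d n) f D q k \<le> bag_err_sample (rat_ltf d n) q k m M + \<epsilon>}) = C N"
      unfolding C_def by auto
    finally show ?thesis .
  qed
  have C_ge: "measure ?S (C N) \<ge> 1 - \<delta>" for N
  proof -
    have "space ?S - C N = {M \<in> space ?S. \<exists>h\<in>rat_ltf d ` {..N}. bag_err_oracle h f D q k > bag_err_sample h q k m M + \<epsilon>}"
      unfolding C_def by (auto simp: not_le)
    then have "measure ?S (space ?S - C N) \<le> \<delta>"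
      using finite_family_bound[of "rat_ltf d ` {..N}", OF _ _ assms] is_ltf_rat_ltf by auto
    then show ?thesis using S.prob_compl[OF C_sets[of N]] by simp
  qed
  have "decseq C" unfolding decseq_def C_def by auto
  then have "(\<lambda>N. measure ?S (C N)) \<longlonglongrightarrow> measure ?S (\<Inter>N. C N)"
    using C_sets by (intro S.finite_Lim_measure_decseq) auto
  then have "measure ?S (\<Inter>N. C N) \<ge> 1 - \<delta>"
    using C_ge by (intro LIMSEQ_le_const) auto
  moreover have "(\<Inter>N. C N) \<in> sets ?S" using C_sets by auto
  moreover have "bag_err_oracle h f D q k \<le> bag_err_sample h q k m M + \<epsilon>"
    if M: "M \<in> (\<Inter>N. C N)" and h: "is_ltf d h" for M h
  proof -
    obtain j where j: "\<And>x. eventually (\<lambda>n. rat_ltf d (j n) x = h x) sequentially"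
      using rat_ltf_approx[OF h] by blast
    show ?thesis
    proof (rule LIMSEQ_le)
      show "(\<lambda>n. bag_err_oracle (rat_ltf d (j n)) f D q k) \<longlonglongrightarrow> bag_err_oracle h f D q k"
        by (rule bag_err_oracle_tendsto[OF h is_ltf_rat_ltf j])
      show "(\<lambda>n. bag_err_sample (rat_ltf d (j n)) q k m M + \<epsilon>) \<longlonglongrightarrow> bag_err_sample h q k m M + \<epsilon>"
        by (intro tendsto_add tendsto_const tendsto_eventually bag_err_sample_eventually_eq j)
      show "\<exists>N. \<forall>n\<ge>N. bag_err_oracle (rat_ltf d (j n)) f D q k \<le> bag_err_sample (rat_ltf d (j n)) q k m M + \<epsilon>"
        using M unfolding C_def by auto
    qed
  qed
  ultimately show ?thesis by blast
qed

theorem theorem8: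
  shows "\<exists>C0::real. C0 \<le> 1000 \<and>
    (\<forall>(d::nat) (D::(nat \<Rightarrow> real) measure) f (q::nat) (k::nat) (\<delta>::real) (\<epsilon>::real) (m::nat).
       prob_space D \<longrightarrow> sets D = sets (PiM {..<d} (\<lambda>_. borel)) \<longrightarrow> 1 \<le> d \<longrightarrow>
       is_ltf d f \<longrightarrow> 2 \<le> q \<longrightarrow> 1 \<le> k \<longrightarrow> k \<le> q - 1 \<longrightarrow>
       emeasure D {x \<in> space D. f x = 1} > 0 \<longrightarrow> emeasure D {x \<in> space D. f x = 0} > 0 \<longrightarrow>
       \<delta> > 0 \<longrightarrow> \<epsilon> > 0 \<longrightarrow>
       real m \<ge> C0 * real d * (ln (real q) + ln (1 / \<delta>)) / \<epsilon>\<^sup>2 \<longrightarrow>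
       (\<exists>A \<in> sets (bag_sample_space D f q k m).
          measure (bag_sample_space D f q k m) A \<ge> 1 - \<delta> \<and>
          (\<forall>M \<in> A. \<forall>h. is_ltf d h \<longrightarrow>
             bag_err_oracle h f D q k \<le> bag_err_sample h q k m M + \<epsilon>)))"
proof (rule exI[of _ 1000], intro conjI allI impI)
  fix d :: nat and D :: "(nat \<Rightarrow> real) measure" and f :: "(nat \<Rightarrow> real) \<Rightarrow> real" and q k :: nat and \<delta> \<epsilon> :: real and m :: nat
  assume *: "prob_space D" "sets D = sets (PiM {..<d} (\<lambda>_. borel))" "1 \<le> d" "2 \<le> q"
    "emeasure D {x \<in> space D. f x = 1} > 0" "emeasure D {x \<in> space D. f x = 0} > 0"
    "\<delta> > 0" "\<epsilon> > 0" "real m \<ge> 1000 * real d * (ln (real q) + ln (1 / \<delta>)) / \<epsilon>\<^sup>2"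
  interpret bag_problem d q k D f by (rule bag_problem.intro[OF *(1,2,5,6)])
  show "\<exists>A \<in> sets (bag_sample_space D f q k m).
      measure (bag_sample_space D f q k m) A \<ge> 1 - \<delta> \<and>
      (\<forall>M \<in> A. \<forall>h. is_ltf d h \<longrightarrow> bag_err_oracle h f D q k \<le> bag_err_sample h q k m M + \<epsilon>)"
  proof (cases "\<delta> < 1")
    case True
    show ?thesis by (rule uniform_bound[OF *(3,4,7) True *(8,9)])
  next
    case False
    \<comment> \<open>For \<open>\<delta> \<ge> 1\<close> the required probability is at most 0, so
      the empty event suffices.\<close>
    then show ?thesis by (intro bexI[of _ "{}"]) simp_all
  qed
qed simp_all

end
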